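(* Let $Q$ be a class $\mathbb{X}$ group, $R=\Bbbk[Q_+]$, and let $I=\langle m_1,\dots,m_r\rangle\subseteq R$ be a monomial ideal with $m_i=x^{q_i}$, $q_i\in Q_+$. If a $Q$-module $M$ is of class $\mathbb{X}$ and, for each $i$, the semigroup $\mathbb{N}q_i$ generated by $q_i$ is Minkowski summable, then the Čech complex $\check C^\bullet_I(M)$ is of class $\mathbb{X}$, and so is its cohomology $H^\bullet_I(M)$.
   Context: $\Bbbk$ is a field. A partially ordered abelian group is an abelian group $Q$ with a submonoid $Q_+$ having trivial unit group, ordered by $q\preceq q'$ iff $q'-q\in Q_+$; it is full if $Q_+$ generates a finite-index subgroup. $Q$ is a class $\mathbb{X}$ group if it is full, is a subgroup of a finite-dimensional real vector space, and $Q_+$ belongs to a family $\mathbb{X}$ of subsets of $Q$ closed under complements, finite unions, negation, and Minkowski sum with $Q_+$. A $Q$-module is a $Q$-graded $\Bbbk$-vector space $M=\bigoplus_q M_q$ with linear maps $M_q\to M_{q'}$ for $q\preceq q'$, functorially (equivalently a $Q$-graded $\Bbbk[Q_+]$-module). A constant subdivision subordinate to $M$ is a partition of $Q$ into regions $I$ with vector spaces $M_I$ and isomorphisms $M_I\to M_i$ ($i\in I$) such that for regions $I,J$, $i\in I$, $j\in J$ with $i\preceq j$, the composite $M_I\to M_i\to M_j\to M_J$ depends only on $I,J$. $M$ is of class $\mathbb{X}$ if $\dim_\Bbbk M_q<\infty$ for all $q$ and it has a subordinate constant subdivision with finitely many regions, all in $\mathbb{X}$. A homomorphism $\phi:M\to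 N$ is of class $\mathbb{X}$ if there is a finite constant subdivision with regions in $\mathbb{X}$ subordinate to both $M$ and $N$ such that for each region $I$ the composite $M_I\to M_i\to N_i\to N_I$ is independent of $i\in I$; a complex is of class $\mathbb{X}$ if all its modules and morphisms are. A class $\mathbb{X}$ set $S$ is Minkowski summable if $S+S'$ is in $\mathbb{X}$ for every $S'\in\mathbb{X}$. The Čech complex is $\check C^\bullet_I: 0\to R\to\bigoplus_i R[m_i^{-1}]\to\cdots\to\bigoplus_{i_1<\dots<i_\ell}R[m_{i_1}^{-1}\cdots m_{i_\ell}^{-1}]\to\cdots\to R[m_1^{-1}\cdots m_r^{-1}]\to0$ with the usual differentials, $\check C^\bullet_I(M)=M\otimes_R\check C^\bullet_I$, and $H^\bullet_I(M)$ is its cohomology (local cohomology). *)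

theory Defs
  imports "HOL-Analysis.Analysis"
begin

record ('k, 'e) kvs =
  vcar :: "'e set"
  vzero :: 'e
  vadd :: "'e \<Rightarrow> 'e \<Rightarrow> 'e"
  vscale :: "'k \<Rightarrow> 'e \<Rightarrow> 'e"

definition is_kvs :: "('k::field, 'e) kvs \<Rightarrow> bool" where
  "is_kvs V \<longleftrightarrow>
     vzero V \<in> vcar V \<and>
     (\<forall>x\<in>vcar V. \<forall>y\<in>vcar V. vadd V x y \<in> vcar V) \<and>
     (\<forall>c. \<forall>x\<in>vcar V. vscale V c x \<in> vcar V) \<and>
     (\<forall>x\<in>vcar V. \<forall>y\<in>vcar V. \<forall>z\<in>vcar V. vadd V (vadd V x y) z = vadd V x (vadd V y z)) \<and>
     (\<forall>x\<in>vcar V. \<forall>y\<in>vcar V. vadd V x y = vadd V y x) \<and>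
     (\<forall>x\<in>vcar V. vadd V (vzero V) x = x) \<and>
     (\<forall>x\<in>vcar V. \<exists>y\<in>vcar V. vadd V x y = vzero V) \<and>
     (\<forall>c. \<forall>x\<in>vcar V. \<forall>y\<in>vcar V. vscale V c (vadd V x y) = vadd V (vscale V c x) (vscale V c y)) \<and>
     (\<forall>c d. \<forall>x\<in>vcar V. vscale V (c + d) x = vadd V (vscale V c x) (vscale V d x)) \<and>
     (\<forall>c d. \<forall>x\<in>vcar V. vscale V (c * d) x = vscale V c (vscale V d x)) \<and>
     (\<forall>x\<in>vcar V. vscale V 1 x = x)"

definition lincomb :: "('k, 'e) kvs \<Rightarrow> 'k list \<Rightarrow> 'e list \<Rightarrow> 'e" where
  "lincomb V cs xs = foldr (\<lambda>(c, x) acc. vadd V (vscale V c x) acc) (zip cs xs) (vzero V)"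

definition fin_dim :: "('k::field, 'e) kvs \<Rightarrow> bool" where
  "fin_dim V \<longleftrightarrow> (\<exists>xs. set xs \<subseteq> vcar V \<and>
      (\<forall>x\<in>vcar V. \<exists>cs. length cs = length xs \<and> x = lincomb V cs xs))"

definition klinear :: "('k::field, 'e) kvs \<Rightarrow> ('k, 'f) kvs \<Rightarrow> ('e \<Rightarrow> 'f) \<Rightarrow> bool" where
  "klinear V W f \<longleftrightarrow>
     (\<forall>x\<in>vcar V. f x \<in> vcar W) \<and>
     (\<forall>x\<in>vcar V. \<forall>y\<in>vcar V. f (vadd V x y) = vadd W (f x) (f y)) \<and>
     (\<forall>c. \<forall>x\<in>vcar V. f (vscale V c x) = vscale W c (f x))"

definition msum :: "'v::ab_group_add set \<Rightarrow> 'v set \<Rightarrow> 'v set" where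
  "msum A B = {a + b | a b. a \<in> A \<and> b \<in> B}"

definition po_group :: "'v::ab_group_add set \<Rightarrow> 'v set \<Rightarrow> bool" where
  "po_group Q Qp \<longleftrightarrow>
     0 \<in> Q \<and> (\<forall>a\<in>Q. \<forall>b\<in>Q. a + b \<in> Q) \<and> (\<forall>a\<in>Q. - a \<in> Q) \<and>
     Qp \<subseteq> Q \<and> 0 \<in> Qp \<and> (\<forall>a\<in>Qp. \<forall>b\<in>Qp. a + b \<in> Qp) \<and>
     (\<forall>a. a \<in> Qp \<and> - a \<in> Qp \<longrightarrow> a = 0)"

definition qle :: "'v::ab_group_add set \<Rightarrow> 'v \<Rightarrow> 'v \<Rightarrow> bool" where
  "qle Qp a b \<longleftrightarrow> b - a \<in> Qp"

text \<open>Full: the subgroup generated by Q+ (which is the set of differences, Q+ being a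
  commutative monoid) has finite index in Q.\<close>
definition full_group :: "'v::ab_group_add set \<Rightarrow> 'v set \<Rightarrow> bool" where
  "full_group Q Qp \<longleftrightarrow>
     (\<exists>F. finite F \<and> F \<subseteq> Q \<and> Q = (\<Union>f\<in>F. {f + (a - b) | a b. a \<in> Qp \<and> b \<in> Qp}))"

definition class_X_family :: "'v set set \<Rightarrow> 'v::ab_group_add set \<Rightarrow> 'v set \<Rightarrow> bool" where
  "class_X_family X Q Qp \<longleftrightarrow>
     (\<forall>S\<in>X. S \<subseteq> Q) \<and>
     (\<forall>S\<in>X. Q - S \<in> X) \<and>
     (\<forall>S\<in>X. \<forall>T\<in>X. S \<union> T \<in> X) \<and>
     (\<forall>S\<in>X. uminus ` S \<in> X) \<and>
     (\<forall>S\<in>X. msum S Qp \<in> X)"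

text \<open>Q is a subgroup of a finite-dimensional real vector space: this is encoded by the
  type class euclidean_space of the ambient type.\<close>
definition class_X_group :: "'v set set \<Rightarrow> 'v::euclidean_space set \<Rightarrow> 'v set \<Rightarrow> bool" where
  "class_X_group X Q Qp \<longleftrightarrow>
     po_group Q Qp \<and> full_group Q Qp \<and> class_X_family X Q Qp \<and> Qp \<in> X"

definition minkowski_summable :: "'v set set \<Rightarrow> 'v::ab_group_add set \<Rightarrow> bool" where
  "minkowski_summable X S \<longleftrightarrow> S \<in> X \<and> (\<forall>S'\<in>X. msum S S' \<in> X)"

definition is_qmod :: "'v::ab_group_add set \<Rightarrow> 'v set \<Rightarrow>
    ('v \<Rightarrow> ('k::field, 'e) kvs) \<Rightarrow> ('v \<Rightarrow> 'v \<Rightarrow> 'e \<Rightarrow> 'e) \<Rightarrow> bool" where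
  "is_qmod Q Qp M mp \<longleftrightarrow>
     (\<forall>q\<in>Q. is_kvs (M q)) \<and>
     (\<forall>q\<in>Q. \<forall>q'\<in>Q. qle Qp q q' \<longrightarrow> klinear (M q) (M q') (mp q q')) \<and>
     (\<forall>q\<in>Q. \<forall>x\<in>vcar (M q). mp q q x = x) \<and>
     (\<forall>q\<in>Q. \<forall>q'\<in>Q. \<forall>q''\<in>Q. qle Qp q q' \<longrightarrow> qle Qp q' q'' \<longrightarrow>
        (\<forall>x\<in>vcar (M q). mp q' q'' (mp q q' x) = mp q q'' x))"

definition is_qhom :: "'v::ab_group_add set \<Rightarrow> 'v set \<Rightarrow>
    ('v \<Rightarrow> ('k::field, 'e) kvs) \<Rightarrow> ('v \<Rightarrow> 'v \<Rightarrow> 'e \<Rightarrow> 'e) \<Rightarrow>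
    ('v \<Rightarrow> ('k, 'f) kvs) \<Rightarrow> ('v \<Rightarrow> 'v \<Rightarrow> 'f \<Rightarrow> 'f) \<Rightarrow> ('v \<Rightarrow> 'e \<Rightarrow> 'f) \<Rightarrow> bool" where
  "is_qhom Q Qp M mp N np phi \<longleftrightarrow>
     is_qmod Q Qp M mp \<and> is_qmod Q Qp N np \<and>
     (\<forall>q\<in>Q. klinear (M q) (N q) (phi q)) \<and>
     (\<forall>q\<in>Q. \<forall>q'\<in>Q. qle Qp q q' \<longrightarrow>
        (\<forall>x\<in>vcar (M q). phi q' (mp q q' x) = np q q' (phi q x)))"

text \<open>A finite constant subdivision with regions in X, subordinate to M:
  partition P of Q, vector spaces MI I, isomorphisms phi I i : MI I \<rightarrow> M i with inverses
  psi I i, such that the composites MI I \<rightarrow> M i \<rightarrow> M j \<rightarrow> MI J depend only on I, J.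
  (The spaces MI I are taken with the same element type as M, which is no restriction.)\<close>
definition const_subdiv :: "'v set set \<Rightarrow> 'v::ab_group_add set \<Rightarrow> 'v set \<Rightarrow>
    ('v \<Rightarrow> ('k::field, 'e) kvs) \<Rightarrow> ('v \<Rightarrow> 'v \<Rightarrow> 'e \<Rightarrow> 'e) \<Rightarrow>
    'v set set \<Rightarrow> ('v set \<Rightarrow> ('k, 'e) kvs) \<Rightarrow>
    ('v set \<Rightarrow> 'v \<Rightarrow> 'e \<Rightarrow> 'e) \<Rightarrow> ('v set \<Rightarrow> 'v \<Rightarrow> 'e \<Rightarrow> 'e) \<Rightarrow> bool" where
  "const_subdiv X Q Qp M mp P MI phi psi \<longleftrightarrow>
     finite P \<and> P \<subseteq> X \<and> (\<forall>I\<in>P. I \<noteq> {}) \<and> \<Union>P = Q \<and>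
     (\<forall>I\<in>P. \<forall>J\<in>P. I \<noteq> J \<longrightarrow> I \<inter> J = {}) \<and>
     (\<forall>I\<in>P. is_kvs (MI I) \<and>
        (\<forall>i\<in>I. klinear (MI I) (M i) (phi I i) \<and> klinear (M i) (MI I) (psi I i) \<and>
           (\<forall>x\<in>vcar (MI I). psi I i (phi I i x) = x) \<and>
           (\<forall>y\<in>vcar (M i). phi I i (psi I i y) = y))) \<and>
     (\<forall>I\<in>P. \<forall>J\<in>P. \<forall>i\<in>I. \<forall>j\<in>J. \<forall>i'\<in>I. \<forall>j'\<in>J.
        qle Qp i j \<longrightarrow> qle Qp i' j' \<longrightarrow>
        (\<forall>x\<in>vcar (MI I). psi J j (mp i j (phi I i x)) = psi J j' (mp i' j' (phi I i' x))))"

definition class_X_module :: "'v set set \<Rightarrow> 'v::ab_group_add set \<Rightarrow> 'v set \<Rightarrow>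
    ('v \<Rightarrow> ('k::field, 'e) kvs) \<Rightarrow> ('v \<Rightarrow> 'v \<Rightarrow> 'e \<Rightarrow> 'e) \<Rightarrow> bool" where
  "class_X_module X Q Qp M mp \<longleftrightarrow>
     is_qmod Q Qp M mp \<and> (\<forall>q\<in>Q. fin_dim (M q)) \<and>
     (\<exists>P MI phi psi. const_subdiv X Q Qp M mp P MI phi psi)"

definition class_X_hom :: "'v set set \<Rightarrow> 'v::ab_group_add set \<Rightarrow> 'v set \<Rightarrow>
    ('v \<Rightarrow> ('k::field, 'e) kvs) \<Rightarrow> ('v \<Rightarrow> 'v \<Rightarrow> 'e \<Rightarrow> 'e) \<Rightarrow>
    ('v \<Rightarrow> ('k, 'f) kvs) \<Rightarrow> ('v \<Rightarrow> 'v \<Rightarrow> 'f \<Rightarrow> 'f) \<Rightarrow> ('v \<Rightarrow> 'e \<Rightarrow> 'f) \<Rightarrow> bool" where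
  "class_X_hom X Q Qp M mp N np phi \<longleftrightarrow>
     is_qhom Q Qp M mp N np phi \<and>
     (\<exists>P MI phiM psiM NI phiN psiN.
        const_subdiv X Q Qp M mp P MI phiM psiM \<and>
        const_subdiv X Q Qp N np P NI phiN psiN \<and>
        (\<forall>I\<in>P. \<forall>i\<in>I. \<forall>i'\<in>I. \<forall>x\<in>vcar (MI I).
           psiN I i (phi i (phiM I i x)) = psiN I i' (phi i' (phiM I i' x))))"

text \<open>M[x^{-p}]_q is the direct limit of M_{q} \<rightarrow> M_{q+p} \<rightarrow> M_{q+2p} \<rightarrow> ...;
  the pair (n, m) with m in M_{q+np} represents m / x^{np}.\<close>

definition lpairs :: "('v::real_vector \<Rightarrow> ('k, 'e) kvs) \<Rightarrow> 'v \<Rightarrow> 'v \<Rightarrow> (nat \<times> 'e) set" where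
  "lpairs M p q = {(n, m). m \<in> vcar (M (q + real n *\<^sub>R p))}"

definition lrel :: "('v::real_vector \<Rightarrow> ('k, 'e) kvs) \<Rightarrow> ('v \<Rightarrow> 'v \<Rightarrow> 'e \<Rightarrow> 'e) \<Rightarrow>
    'v \<Rightarrow> 'v \<Rightarrow> nat \<times> 'e \<Rightarrow> nat \<times> 'e \<Rightarrow> bool" where
  "lrel M mp p q a b \<longleftrightarrow> a \<in> lpairs M p q \<and> b \<in> lpairs M p q \<and>
     (\<exists>k. mp (q + real (fst a) *\<^sub>R p) (q + real (fst a + fst b + k) *\<^sub>R p) (snd a) =
          mp (q + real (fst b) *\<^sub>R p) (q + real (fst a + fst b + k) *\<^sub>R p) (snd b))"

definition lcls :: "('v::real_vector \<Rightarrow> ('k, 'e) kvs) \<Rightarrow> ('v \<Rightarrow> 'v \<Rightarrow> 'e \<Rightarrow> 'e) \<Rightarrow>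
    'v \<Rightarrow> 'v \<Rightarrow> nat \<times> 'e \<Rightarrow> (nat \<times> 'e) set" where
  "lcls M mp p q a = {b. lrel M mp p q a b}"

definition loc_kvs :: "('v::real_vector \<Rightarrow> ('k, 'e) kvs) \<Rightarrow> ('v \<Rightarrow> 'v \<Rightarrow> 'e \<Rightarrow> 'e) \<Rightarrow>
    'v \<Rightarrow> 'v \<Rightarrow> ('k, (nat \<times> 'e) set) kvs" where
  "loc_kvs M mp p q =
     \<lparr> vcar = lcls M mp p q ` lpairs M p q,
       vzero = lcls M mp p q (0, vzero (M q)),
       vadd = (\<lambda>A B. let a = (SOME a. a \<in> A); b = (SOME b. b \<in> B); n = fst a + fst b in
                lcls M mp p q (n, vadd (M (q + real n *\<^sub>R p))
                   (mp (q + real (fst a) *\<^sub>R p) (q + real n *\<^sub>R p) (snd a))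
                   (mp (q + real (fst b) *\<^sub>R p) (q + real n *\<^sub>R p) (snd b)))),
       vscale = (\<lambda>c A. let a = (SOME a. a \<in> A) in
                lcls M mp p q (fst a, vscale (M (q + real (fst a) *\<^sub>R p)) c (snd a))) \<rparr>"

definition loc_map :: "('v::real_vector \<Rightarrow> ('k, 'e) kvs) \<Rightarrow> ('v \<Rightarrow> 'v \<Rightarrow> 'e \<Rightarrow> 'e) \<Rightarrow>
    'v \<Rightarrow> 'v \<Rightarrow> 'v \<Rightarrow> (nat \<times> 'e) set \<Rightarrow> (nat \<times> 'e) set" where
  "loc_map M mp p q q' A = (let a = (SOME a. a \<in> A) in
     lcls M mp p q' (fst a, mp (q + real (fst a) *\<^sub>R p) (q' + real (fst a) *\<^sub>R p) (snd a)))"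

text \<open>Natural map M[x^{-p}] \<rightarrow> M[x^{-p'}] in degree q, for p' = p + u with u in Q+.\<close>
definition loc_change :: "('v::real_vector \<Rightarrow> ('k, 'e) kvs) \<Rightarrow> ('v \<Rightarrow> 'v \<Rightarrow> 'e \<Rightarrow> 'e) \<Rightarrow>
    'v \<Rightarrow> 'v \<Rightarrow> 'v \<Rightarrow> (nat \<times> 'e) set \<Rightarrow> (nat \<times> 'e) set" where
  "loc_change M mp p p' q A = (let a = (SOME a. a \<in> A) in
     lcls M mp p' q (fst a, mp (q + real (fst a) *\<^sub>R p) (q + real (fst a) *\<^sub>R p') (snd a)))"

definition psum :: "'v::real_vector list \<Rightarrow> nat set \<Rightarrow> 'v" where
  "psum qs S = (\<Sum>i\<in>S. qs ! i)"

definition csets :: "nat \<Rightarrow> nat \<Rightarrow> nat set set" where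
  "csets r l = {S. S \<subseteq> {..<r} \<and> card S = l}"

text \<open>Cech term in cohomological degree l, Q-degree q: the direct sum over index sets S of
  size l of M \<otimes>_R R[m_S^{-1}] = M[x^{-psum qs S}].\<close>
definition cech :: "('v::real_vector \<Rightarrow> ('k, 'e) kvs) \<Rightarrow> ('v \<Rightarrow> 'v \<Rightarrow> 'e \<Rightarrow> 'e) \<Rightarrow>
    'v list \<Rightarrow> nat \<Rightarrow> 'v \<Rightarrow> ('k, nat set \<Rightarrow> (nat \<times> 'e) set) kvs" where
  "cech M mp qs l q =
     \<lparr> vcar = {f. (\<forall>S\<in>csets (length qs) l. f S \<in> vcar (loc_kvs M mp (psum qs S) q)) \<and>
                 (\<forall>S. S \<notin> csets (length qs) l \<longrightarrow> f S = undefined)},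
       vzero = (\<lambda>S. if S \<in> csets (length qs) l then vzero (loc_kvs M mp (psum qs S) q) else undefined),
       vadd = (\<lambda>f g S. if S \<in> csets (length qs) l
                then vadd (loc_kvs M mp (psum qs S) q) (f S) (g S) else undefined),
       vscale = (\<lambda>c f S. if S \<in> csets (length qs) l
                then vscale (loc_kvs M mp (psum qs S) q) c (f S) else undefined) \<rparr>"

definition cech_map :: "('v::real_vector \<Rightarrow> ('k, 'e) kvs) \<Rightarrow> ('v \<Rightarrow> 'v \<Rightarrow> 'e \<Rightarrow> 'e) \<Rightarrow>
    'v list \<Rightarrow> nat \<Rightarrow> 'v \<Rightarrow> 'v \<Rightarrow> (nat set \<Rightarrow> (nat \<times> 'e) set) \<Rightarrow> (nat set \<Rightarrow> (nat \<times> 'e) set)" where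
  "cech_map M mp qs l q q' f =
     (\<lambda>S. if S \<in> csets (length qs) l then loc_map M mp (psum qs S) q q' (f S) else undefined)"

definition cech_d :: "('v::real_vector \<Rightarrow> ('k::field, 'e) kvs) \<Rightarrow> ('v \<Rightarrow> 'v \<Rightarrow> 'e \<Rightarrow> 'e) \<Rightarrow>
    'v list \<Rightarrow> nat \<Rightarrow> 'v \<Rightarrow> (nat set \<Rightarrow> (nat \<times> 'e) set) \<Rightarrow> (nat set \<Rightarrow> (nat \<times> 'e) set)" where
  "cech_d M mp qs l q f =
     (\<lambda>T. if T \<in> csets (length qs) (Suc l) then
        foldr (vadd (loc_kvs M mp (psum qs T) q))
          (map (\<lambda>j. vscale (loc_kvs M mp (psum qs T) q) ((-1) ^ card {i\<in>T. i < j})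
                       (loc_change M mp (psum qs (T - {j})) (psum qs T) q (f (T - {j}))))
               (sorted_list_of_set T))
          (vzero (loc_kvs M mp (psum qs T) q))
      else undefined)"

definition coset :: "('k, 'e) kvs \<Rightarrow> 'e set \<Rightarrow> 'e \<Rightarrow> 'e set" where
  "coset V B x = (\<lambda>b. vadd V x b) ` B"

definition quot_kvs :: "('k, 'e) kvs \<Rightarrow> 'e set \<Rightarrow> 'e set \<Rightarrow> ('k, 'e set) kvs" where
  "quot_kvs V K B =
     \<lparr> vcar = coset V B ` K,
       vzero = coset V B (vzero V),
       vadd = (\<lambda>A C. coset V B (vadd V (SOME x. x \<in> A) (SOME y. y \<in> C))),
       vscale = (\<lambda>c A. coset V B (vscale V c (SOME x. x \<in> A))) \<rparr>"

definition cech_cycles :: "('v::real_vector \<Rightarrow> ('k::field, 'e) kvs) \<Rightarrow> ('v \<Rightarrow> 'v \<Rightarrow> 'e \<Rightarrow> 'e) \<Rightarrow>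
    'v list \<Rightarrow> nat \<Rightarrow> 'v \<Rightarrow> (nat set \<Rightarrow> (nat \<times> 'e) set) set" where
  "cech_cycles M mp qs l q =
     {f \<in> vcar (cech M mp qs l q). cech_d M mp qs l q f = vzero (cech M mp qs (Suc l) q)}"

definition cech_bounds :: "('v::real_vector \<Rightarrow> ('k::field, 'e) kvs) \<Rightarrow> ('v \<Rightarrow> 'v \<Rightarrow> 'e \<Rightarrow> 'e) \<Rightarrow>
    'v list \<Rightarrow> nat \<Rightarrow> 'v \<Rightarrow> (nat set \<Rightarrow> (nat \<times> 'e) set) set" where
  "cech_bounds M mp qs l q =
     (case l of 0 \<Rightarrow> {vzero (cech M mp qs 0 q)}
      | Suc l' \<Rightarrow> cech_d M mp qs l' q ` vcar (cech M mp qs l' q))"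

definition loccoh :: "('v::real_vector \<Rightarrow> ('k::field, 'e) kvs) \<Rightarrow> ('v \<Rightarrow> 'v \<Rightarrow> 'e \<Rightarrow> 'e) \<Rightarrow>
    'v list \<Rightarrow> nat \<Rightarrow> 'v \<Rightarrow> ('k, (nat set \<Rightarrow> (nat \<times> 'e) set) set) kvs" where
  "loccoh M mp qs l q = quot_kvs (cech M mp qs l q) (cech_cycles M mp qs l q) (cech_bounds M mp qs l q)"

definition loccoh_map :: "('v::real_vector \<Rightarrow> ('k::field, 'e) kvs) \<Rightarrow> ('v \<Rightarrow> 'v \<Rightarrow> 'e \<Rightarrow> 'e) \<Rightarrow>
    'v list \<Rightarrow> nat \<Rightarrow> 'v \<Rightarrow> 'v \<Rightarrow> (nat set \<Rightarrow> (nat \<times> 'e) set) set \<Rightarrow> (nat set \<Rightarrow> (nat \<times> 'e) set) set" where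
  "loccoh_map M mp qs l q q' A =
     coset (cech M mp qs l q') (cech_bounds M mp qs l q') (cech_map M mp qs l q q' (SOME f. f \<in> A))"

end

theory Submission
  imports Defs
begin

text \<open>Comparing \<open>M_i \<rightarrow> M_j\<close> with \<open>M_i \<rightarrow> M_i\<close> in a constant subdivision shows that \<open>M_i \<rightarrow> M_j\<close> is an
  isomorphism whenever \<open>i \<preceq> j\<close> lie in one region \<open>I\<close>. Hence \<open>M[m_S^{-1}]_q\<close> is canonically \<open>M_I\<close> for
  every \<open>q\<close> whose translates by the semigroup \<open>C\<close> generated by the \<open>q_i\<close>, \<open>i \<in> S\<close>, keep returning
  to \<open>I\<close>. The set of these \<open>q\<close> is \<open>Q \<setminus> ((Q \<setminus> (I - C)) - C)\<close>, which lies in \<open>X\<close> by Minkowski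
  summability, and by the pigeonhole principle these sets cover \<open>Q\<close> as \<open>I\<close> varies. Over the atoms of
  the Boolean algebra that they generate for all \<open>S\<close> and \<open>I\<close>, all localizations are identified
  along each region at once. These identifications (called transport) commute with the structure
  maps and with the differentials, so they descend to subquotients, in particular to cohomology.
  A transport yields a constant subdivision whose space \<open>M_I\<close> is that of a chosen point of \<open>I\<close>.\<close>

text \<open>Only the semigroups \<open>N q_i\<close> are assumed summable, not the one generated by
  \<open>psum qs S\<close>, along which the localization is formed. The regions are therefore
  defined by returns to \<open>I\<close> along the cone \<open>ncone qs S\<close>, a finite
  Minkowski sum of the \<open>N q_i\<close>. The multiples of \<open>psum qs S\<close> lie in this
  cone and are cofinal in it, so these returns still control the direct limit. A region may be left
  and re-entered forever: as the maps inside it are isomorphisms, returning again and again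
  determines the limit as well as staying would. A second obstacle is formal.
  \<open>const_subdiv\<close> wants spaces with the element type of the module, and the Cech terms
  and their cohomology have other element types than \<open>MI\<close>. Comparing the fibres over a
  region with each other, instead of with an external space, stays inside one type.\<close>

section \<open>Vector spaces given by carrier records\<close>

locale kvspace =
  fixes V :: "('k::field, 'e) kvs"
  assumes is_kvs: "is_kvs V"
begin

lemma zero_closed [simp]: "vzero V \<in> vcar V"
  and add_closed [simp]: "x \<in> vcar V \<Longrightarrow> y \<in> vcar V \<Longrightarrow> vadd V x y \<in> vcar V"
  and scale_closed [simp]: "x \<in> vcar V \<Longrightarrow> vscale V c x \<in> vcar V"
  and add_assoc: "x \<in> vcar V \<Longrightarrow> y \<in> vcar V \<Longrightarrow> z \<in> vcar V \<Longrightarrow>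
    vadd V (vadd V x y) z = vadd V x (vadd V y z)"
  and add_commute: "x \<in> vcar V \<Longrightarrow> y \<in> vcar V \<Longrightarrow> vadd V x y = vadd V y x"
  and zero_left [simp]: "x \<in> vcar V \<Longrightarrow> vadd V (vzero V) x = x"
  and neg_ex: "x \<in> vcar V \<Longrightarrow> \<exists>y\<in>vcar V. vadd V x y = vzero V"
  and scale_add_right: "x \<in> vcar V \<Longrightarrow> y \<in> vcar V \<Longrightarrow>
    vscale V c (vadd V x y) = vadd V (vscale V c x) (vscale V c y)"
  and scale_add_left: "x \<in> vcar V \<Longrightarrow> vscale V (c + d) x = vadd V (vscale V c x) (vscale V d x)"
  and scale_scale: "x \<in> vcar V \<Longrightarrow> vscale V c (vscale V d x) = vscale V (c * d) x"
  and scale_one [simp]: "x \<in> vcar V \<Longrightarrow> vscale V 1 x = x"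
proof -
  note k = is_kvs[unfolded is_kvs_def]
  show "vzero V \<in> vcar V" using k by simp
  show "x \<in> vcar V \<Longrightarrow> y \<in> vcar V \<Longrightarrow> vadd V x y \<in> vcar V" using k by simp
  show "x \<in> vcar V \<Longrightarrow> vscale V c x \<in> vcar V" using k by simp
  show "x \<in> vcar V \<Longrightarrow> y \<in> vcar V \<Longrightarrow> z \<in> vcar V \<Longrightarrow>
    vadd V (vadd V x y) z = vadd V x (vadd V y z)" using k by meson
  show "x \<in> vcar V \<Longrightarrow> y \<in> vcar V \<Longrightarrow> vadd V x y = vadd V y x" using k by meson
  show "x \<in> vcar V \<Longrightarrow> vadd V (vzero V) x = x" using k by meson
  show "x \<in> vcar V \<Longrightarrow> \<exists>y\<in>vcar V. vadd V x y = vzero V" using k by meson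
  show "x \<in> vcar V \<Longrightarrow> y \<in> vcar V \<Longrightarrow>
    vscale V c (vadd V x y) = vadd V (vscale V c x) (vscale V c y)" using k by meson
  show "x \<in> vcar V \<Longrightarrow> vscale V (c + d) x = vadd V (vscale V c x) (vscale V d x)" using k by meson
  show "x \<in> vcar V \<Longrightarrow> vscale V c (vscale V d x) = vscale V (c * d) x" using k by metis
  show "x \<in> vcar V \<Longrightarrow> vscale V 1 x = x" using k by meson
qed

lemma zero_right [simp]: "x \<in> vcar V \<Longrightarrow> vadd V x (vzero V) = x"
  using add_commute[of x "vzero V"] by simp

lemma add_left_commute:
  "x \<in> vcar V \<Longrightarrow> y \<in> vcar V \<Longrightarrow> z \<in> vcar V \<Longrightarrow> vadd V x (vadd V y z) = vadd V y (vadd V x z)"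
  by (metis add_assoc add_commute)

lemma add_add_swap:
  assumes "x \<in> vcar V" "y \<in> vcar V" "z \<in> vcar V" "w \<in> vcar V"
  shows "vadd V (vadd V x y) (vadd V z w) = vadd V (vadd V x z) (vadd V y w)"
  using assms by (simp add: add_assoc add_left_commute[of y z w])

lemma add_left_cancel:
  assumes "x \<in> vcar V" "y \<in> vcar V" "z \<in> vcar V" "vadd V x y = vadd V x z"
  shows "y = z"
proof -
  obtain n where n: "n \<in> vcar V" "vadd V x n = vzero V"
    using neg_ex assms(1) by blast
  then have "vadd V n x = vzero V"
    using add_commute assms(1) by simp
  then show ?thesis
    using add_assoc[of n x y] add_assoc[of n x z] assms n(1) by simp
qed

lemma scale_zero_left [simp]: "x \<in> vcar V \<Longrightarrow> vscale V 0 x = vzero V"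
  using add_left_cancel[of "vscale V 0 x" "vscale V 0 x" "vzero V"] scale_add_left[of x 0 0] by simp

lemma scale_zero_right [simp]: "vscale V c (vzero V) = vzero V"
  using scale_scale[of "vzero V" c 0] by simp

lemma add_neg: "x \<in> vcar V \<Longrightarrow> vadd V (vscale V c x) (vscale V (- c) x) = vzero V"
  using scale_add_left[of x c "- c"] by simp

end

lemma is_kvsI:
  assumes "vzero V \<in> vcar V"
    and "\<And>x y. x \<in> vcar V \<Longrightarrow> y \<in> vcar V \<Longrightarrow> vadd V x y \<in> vcar V"
    and "\<And>c x. x \<in> vcar V \<Longrightarrow> vscale V c x \<in> vcar V"
    and "\<And>x y z. x \<in> vcar V \<Longrightarrow> y \<in> vcar V \<Longrightarrow> z \<in> vcar V \<Longrightarrow>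
      vadd V (vadd V x y) z = vadd V x (vadd V y z)"
    and "\<And>x y. x \<in> vcar V \<Longrightarrow> y \<in> vcar V \<Longrightarrow> vadd V x y = vadd V y x"
    and "\<And>x. x \<in> vcar V \<Longrightarrow> vadd V (vzero V) x = x"
    and "\<And>x. x \<in> vcar V \<Longrightarrow> \<exists>y\<in>vcar V. vadd V x y = vzero V"
    and "\<And>c x y. x \<in> vcar V \<Longrightarrow> y \<in> vcar V \<Longrightarrow>
      vscale V c (vadd V x y) = vadd V (vscale V c x) (vscale V c y)"
    and "\<And>c d x. x \<in> vcar V \<Longrightarrow> vscale V (c + d) x = vadd V (vscale V c x) (vscale V d x)"
    and "\<And>c d x. x \<in> vcar V \<Longrightarrow> vscale V (c * d) x = vscale V c (vscale V d x)"
    and "\<And>x. x \<in> vcar V \<Longrightarrow> vscale V 1 x = x"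
  shows "is_kvs V"
  unfolding is_kvs_def by (intro conjI ballI allI assms)

lemma klinearD:
  assumes "klinear V W f"
  shows "x \<in> vcar V \<Longrightarrow> f x \<in> vcar W"
    and "x \<in> vcar V \<Longrightarrow> y \<in> vcar V \<Longrightarrow> f (vadd V x y) = vadd W (f x) (f y)"
    and "x \<in> vcar V \<Longrightarrow> f (vscale V c x) = vscale W c (f x)"
  using assms unfolding klinear_def by auto

lemma klinearI:
  assumes "\<And>x. x \<in> vcar V \<Longrightarrow> f x \<in> vcar W"
    and "\<And>x y. x \<in> vcar V \<Longrightarrow> y \<in> vcar V \<Longrightarrow> f (vadd V x y) = vadd W (f x) (f y)"
    and "\<And>c x. x \<in> vcar V \<Longrightarrow> f (vscale V c x) = vscale W c (f x)"
  shows "klinear V W f"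
  using assms unfolding klinear_def by auto

lemma klinear_zero:
  assumes "is_kvs V" "is_kvs W" "klinear V W f"
  shows "f (vzero V) = vzero W"
proof -
  interpret V: kvspace V using assms by unfold_locales
  interpret W: kvspace W using assms by unfold_locales
  show ?thesis
    using klinearD(3)[OF assms(3) V.zero_closed, of 0] klinearD(1)[OF assms(3) V.zero_closed] by simp
qed

lemma klinear_comp:
  assumes "klinear U V f" "klinear V W g"
  shows "klinear U W (\<lambda>x. g (f x))"
  by (rule klinearI) (simp_all add: klinearD[OF assms(1)] klinearD[OF assms(2)])

lemma klinear_add:
  assumes "is_kvs W" "klinear V W f" "klinear V W g"
  shows "klinear V W (\<lambda>x. vadd W (f x) (g x))"
proof -
  interpret kvspace W using assms by unfold_locales
  show ?thesis
    by (rule klinearI)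
      (simp_all add: klinearD[OF assms(2)] klinearD[OF assms(3)] add_add_swap scale_add_right)
qed

lemma klinear_scale:
  assumes "is_kvs W" "klinear V W f"
  shows "klinear V W (\<lambda>x. vscale W c (f x))"
proof -
  interpret kvspace W using assms by unfold_locales
  show ?thesis
    by (rule klinearI)
      (simp_all add: klinearD[OF assms(2)] scale_add_right scale_scale mult.commute)
qed

lemma klinear_zero_map:
  assumes "is_kvs W"
  shows "klinear V W (\<lambda>x. vzero W)"
proof -
  interpret kvspace W using assms by unfold_locales
  show ?thesis
    by (rule klinearI) simp_all
qed

lemma klinear_foldr:
  assumes "is_kvs W" "\<And>j. j \<in> set js \<Longrightarrow> klinear V W (\<lambda>x. F x j)"
  shows "klinear V W (\<lambda>x. foldr (vadd W) (map (F x) js) (vzero W))"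
  using assms(2) by (induction js) (simp_all add: klinear_zero_map klinear_add assms(1))

lemma klinear_apply_foldr:
  assumes "is_kvs V" "is_kvs W" "klinear V W f" "\<And>j. j \<in> set js \<Longrightarrow> F j \<in> vcar V"
  shows "f (foldr (vadd V) (map F js) (vzero V)) = foldr (vadd W) (map (\<lambda>j. f (F j)) js) (vzero W)"
proof -
  interpret kvspace V using assms by unfold_locales
  have "f (foldr (vadd V) (map F js) (vzero V)) = foldr (vadd W) (map (\<lambda>j. f (F j)) js) (vzero W) \<and>
      foldr (vadd V) (map F js) (vzero V) \<in> vcar V"
    using assms(4) by (induction js) (auto simp: klinear_zero[OF assms(1-3)] klinearD[OF assms(3)])
  then show ?thesis ..
qed

text \<open>The axioms are equations, or the existence of negatives, and pass to the image of a map
  that respects the operations. As \<open>W\<close> is not yet known to be a vector space, its zero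
  cannot be recovered as \<open>0\<close> times a vector, so \<open>zero\<close> is a hypothesis.
  Quotients and localizations get their axioms from here.\<close>

lemma is_kvs_surj:
  assumes V: "is_kvs V" and f: "klinear V W f" and surj: "f ` vcar V = vcar W"
    and zero: "f (vzero V) = vzero W"
  shows "is_kvs W"
proof -
  interpret kvspace V using V by unfold_locales
  note fD = klinearD(2,3)[OF f, symmetric]
  have "\<exists>z\<in>vcar V. vadd W (f x) (f z) = vzero W" if "x \<in> vcar V" for x
  proof -
    obtain y where "y \<in> vcar V" "vadd V x y = vzero V" using neg_ex[OF \<open>x \<in> vcar V\<close>] by blast
    then show ?thesis using that by (intro bexI[of _ y]) (simp_all add: fD zero)
  qed
  moreover have "f (vadd V x y) = f (vadd V y x)" if "x \<in> vcar V" "y \<in> vcar V" for x y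
    using add_commute[OF that] by simp
  ultimately show ?thesis
    by (intro is_kvsI)
      (auto simp: surj[symmetric] fD zero[symmetric] add_assoc scale_add_right scale_add_left
        scale_scale)
qed

section \<open>Spans and finite dimension\<close>

text \<open>Only the operations enter, not the carrier, so spans in a subspace and in the ambient
  space coincide. Finite sets thereby replace the coefficient lists of
  \<open>fin_dim\<close>.\<close>

inductive_set kspan :: "('k, 'e) kvs \<Rightarrow> 'e set \<Rightarrow> 'e set" for V A where
  zero: "vzero V \<in> kspan V A"
| step: "a \<in> A \<Longrightarrow> x \<in> kspan V A \<Longrightarrow> vadd V (vscale V c a) x \<in> kspan V A"

lemma kspan_mono: "A \<subseteq> B \<Longrightarrow> kspan V A \<subseteq> kspan V B"
proof
  fix x assume "A \<subseteq> B" "x \<in> kspan V A"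
  from this(2) show "x \<in> kspan V B"
    by induction (use \<open>A \<subseteq> B\<close> in \<open>auto intro: kspan.intros\<close>)
qed

lemma kspan_restrict: "kspan (V\<lparr>vcar := K\<rparr>) A = kspan V A"
proof (intro equalityI subsetI)
  fix x assume "x \<in> kspan (V\<lparr>vcar := K\<rparr>) A"
  then show "x \<in> kspan V A"
    by induction (auto intro: kspan.intros)
next
  fix x assume "x \<in> kspan V A"
  then show "x \<in> kspan (V\<lparr>vcar := K\<rparr>) A"
  proof induction
    case zero
    then show ?case using kspan.zero[of "V\<lparr>vcar := K\<rparr>" A] by simp
  next
    case (step a x c)
    then show ?case using kspan.step[of a A x "V\<lparr>vcar := K\<rparr>" c] by simp
  qed
qed

context kvspace
begin

lemma kspan_closed: "A \<subseteq> vcar V \<Longrightarrow> x \<in> kspan V A \<Longrightarrow> x \<in> vcar V"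
  by (rotate_tac, induction rule: kspan.induct) auto

lemma kspan_add:
  assumes "A \<subseteq> vcar V" "x \<in> kspan V A" "y \<in> kspan V A"
  shows "vadd V x y \<in> kspan V A"
  using assms(2)
proof induction
  case zero
  then show ?case using assms kspan_closed by auto
next
  case (step a x c)
  then have "vadd V (vadd V (vscale V c a) x) y = vadd V (vscale V c a) (vadd V x y)"
    using assms kspan_closed by (auto intro!: add_assoc)
  then show ?case using step by (auto intro: kspan.step)
qed

lemma kspan_scale:
  assumes "A \<subseteq> vcar V" "x \<in> kspan V A"
  shows "vscale V c x \<in> kspan V A"
  using assms(2)
proof induction
  case zero
  then show ?case by (auto intro: kspan.zero)
next
  case (step a x d)
  then have "vscale V c (vadd V (vscale V d a) x) = vadd V (vscale V (c * d) a) (vscale V c x)"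
    using assms(1) kspan_closed[OF assms(1)] by (auto simp: subset_eq scale_add_right scale_scale)
  then show ?case using step by (auto intro: kspan.step)
qed

text \<open>All multiples of \<open>a\<close> that occur in a combination are collected into one
  coefficient. Both the conversion to coefficient lists and the elimination in
  \<open>ksub_spanned\<close> rest on this.\<close>

lemma kspan_insertE:
  assumes "insert a A \<subseteq> vcar V" "x \<in> kspan V (insert a A)"
  obtains c y where "y \<in> kspan V A" "x = vadd V (vscale V c a) y"
proof -
  have A: "A \<subseteq> vcar V" and a: "a \<in> vcar V" using assms(1) by auto
  from assms(2) have "\<exists>c. \<exists>y\<in>kspan V A. x = vadd V (vscale V c a) y"
  proof induction
    case zero
    show ?case
      by (rule exI[of _ 0], rule bexI[of _ "vzero V"]) (auto simp: a kspan.zero)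
  next
    case (step b x d)
    then obtain c y where y: "y \<in> kspan V A" "x = vadd V (vscale V c a) y" by blast
    have yV: "y \<in> vcar V" using kspan_closed[OF A y(1)] .
    show ?case
    proof (cases "b = a")
      case True
      have "vadd V (vscale V d b) x = vadd V (vscale V (d + c) a) y"
        using True y(2) yV a by (simp add: scale_add_left add_assoc)
      then show ?thesis using y(1) by blast
    next
      case False
      then have b: "b \<in> A" using step.hyps by auto
      then have "vadd V (vscale V d b) x = vadd V (vscale V c a) (vadd V (vscale V d b) y)"
        using y(2) yV a A by (auto intro!: add_left_commute)
      then show ?thesis using y(1) b by (blast intro: kspan.step)
    qed
  qed
  then show thesis using that by blast
qed

lemma lincomb_in_kspan:
  "length cs = length xs \<Longrightarrow> set xs \<subseteq> A \<Longrightarrow> lincomb V cs xs \<in> kspan V A"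
  by (induction cs xs rule: list_induct2) (auto simp: lincomb_def intro: kspan.intros)

lemma kspan_lincomb:
  "set xs \<subseteq> vcar V \<Longrightarrow> x \<in> kspan V (set xs) \<Longrightarrow> \<exists>cs. length cs = length xs \<and> x = lincomb V cs xs"
proof (induction xs arbitrary: x)
  case Nil
  from Nil(2) have "x = vzero V" by cases auto
  then show ?case by (simp add: lincomb_def)
next
  case (Cons a xs)
  obtain c y where y: "y \<in> kspan V (set xs)" "x = vadd V (vscale V c a) y"
    by (rule kspan_insertE[of a "set xs" x]) (use Cons.prems in auto)
  obtain cs where "length cs = length xs" "y = lincomb V cs xs"
    using Cons.IH[OF _ y(1)] Cons.prems by auto
  then have "length (c # cs) = length (a # xs) \<and> x = lincomb V (c # cs) (a # xs)"
    using y(2) by (simp add: lincomb_def)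
  then show ?case by blast
qed

lemma fin_dim_iff: "fin_dim V \<longleftrightarrow> (\<exists>A. finite A \<and> A \<subseteq> vcar V \<and> vcar V \<subseteq> kspan V A)"
proof
  assume "fin_dim V"
  then obtain xs where "set xs \<subseteq> vcar V"
    "\<forall>x\<in>vcar V. \<exists>cs. length cs = length xs \<and> x = lincomb V cs xs"
    unfolding fin_dim_def by blast
  then show "\<exists>A. finite A \<and> A \<subseteq> vcar V \<and> vcar V \<subseteq> kspan V A"
    by (intro exI[of _ "set xs"]) (auto intro: lincomb_in_kspan)
next
  assume "\<exists>A. finite A \<and> A \<subseteq> vcar V \<and> vcar V \<subseteq> kspan V A"
  then obtain A where A: "finite A" "A \<subseteq> vcar V" "vcar V \<subseteq> kspan V A" by blast
  obtain xs where "set xs = A" using finite_list[OF A(1)] by blast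
  then show "fin_dim V"
    unfolding fin_dim_def using A kspan_lincomb[of xs] by blast
qed

end

lemma kspan_image:
  assumes "klinear V W f" "is_kvs V" "f (vzero V) = vzero W" "A \<subseteq> vcar V" "x \<in> kspan V A"
  shows "f x \<in> kspan W (f ` A)"
proof -
  interpret kvspace V using assms by unfold_locales
  from assms(5) show ?thesis
  proof induction
    case zero
    then show ?case using assms by (auto intro: kspan.zero)
  next
    case (step a x c)
    have "f (vadd V (vscale V c a) x) = vadd W (vscale W c (f a)) (f x)"
      using klinearD[OF assms(1)] step.hyps assms(4) kspan_closed[OF assms(4)]
      by (auto simp: subset_eq)
    then show ?case using step by (auto intro: kspan.step)
  qed
qed

lemma fin_dim_surj:
  assumes V: "is_kvs V" "fin_dim V" and f: "klinear V W f" and surj: "f ` vcar V = vcar W"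
    and zero: "f (vzero V) = vzero W"
  shows "fin_dim W"
proof -
  interpret V: kvspace V using V by unfold_locales
  interpret W: kvspace W using is_kvs_surj[OF V(1) f surj zero] by unfold_locales
  obtain A where A: "finite A" "A \<subseteq> vcar V" "vcar V \<subseteq> kspan V A"
    using V(2) unfolding V.fin_dim_iff by blast
  have "vcar W \<subseteq> kspan W (f ` A)"
  proof
    fix y assume "y \<in> vcar W"
    then obtain x where "x \<in> vcar V" "y = f x" using surj by auto
    then show "y \<in> kspan W (f ` A)" using kspan_image[OF f V(1) zero A(2)] A(3) by auto
  qed
  moreover have "finite (f ` A)" "f ` A \<subseteq> vcar W"
    using A(1,2) surj by auto
  ultimately show ?thesis
    unfolding W.fin_dim_iff by blast
qed

section \<open>Subspaces and quotients\<close>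

definition ksub :: "('k::field, 'e) kvs \<Rightarrow> 'e set \<Rightarrow> bool" where
  "ksub V K \<longleftrightarrow> K \<subseteq> vcar V \<and> vzero V \<in> K \<and>
     (\<forall>x\<in>K. \<forall>y\<in>K. vadd V x y \<in> K) \<and> (\<forall>c. \<forall>x\<in>K. vscale V c x \<in> K)"

lemma ksubD:
  assumes "ksub V K"
  shows "K \<subseteq> vcar V" "x \<in> K \<Longrightarrow> x \<in> vcar V" "vzero V \<in> K"
    "x \<in> K \<Longrightarrow> y \<in> K \<Longrightarrow> vadd V x y \<in> K" "x \<in> K \<Longrightarrow> vscale V c x \<in> K"
  using assms unfolding ksub_def by auto

lemma ksub_kernel:
  assumes "is_kvs V" "is_kvs W" "klinear V W f"
  shows "ksub V {x \<in> vcar V. f x = vzero W}"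
proof -
  interpret V: kvspace V using assms by unfold_locales
  interpret W: kvspace W using assms by unfold_locales
  show ?thesis
    unfolding ksub_def using klinear_zero[OF assms] by (auto simp: klinearD[OF assms(3)])
qed

lemma ksub_image:
  assumes "is_kvs V" "is_kvs W" "klinear V W f"
  shows "ksub W (f ` vcar V)"
proof -
  interpret V: kvspace V using assms by unfold_locales
  show ?thesis
    unfolding ksub_def
    by (auto simp: klinearD(1)[OF assms(3)] klinearD(2,3)[OF assms(3), symmetric]
        klinear_zero[OF assms, symmetric])
qed

lemma ksub_zero: "is_kvs V \<Longrightarrow> ksub V {vzero V}"
proof -
  assume "is_kvs V"
  then interpret kvspace V by unfold_locales
  show ?thesis unfolding ksub_def by auto
qed

context kvspace
begin

lemma ksub_is_kvs:
  assumes "ksub V K"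
  shows "is_kvs (V\<lparr>vcar := K\<rparr>)"
proof -
  note K = ksubD[OF assms]
  have "\<exists>y\<in>K. vadd V x y = vzero V" if "x \<in> K" for x
    using add_neg[of x 1] K(2,5) that by (intro bexI[of _ "vscale V (- 1) x"]) auto
  then show ?thesis
    by (intro is_kvsI)
      (auto simp: K(2-5) add_assoc scale_add_right scale_add_left scale_scale intro: add_commute)
qed

text \<open>Gaussian elimination: \<open>K \<inter> kspan V A\<close> is finitely spanned by
  induction. If \<open>K\<close> is larger, a single \<open>w\<close> in \<open>K\<close> with
  nonzero coefficient at \<open>a\<close> supplies the rest, since subtracting a multiple of
  \<open>w\<close> moves any vector of \<open>K\<close> into \<open>kspan V A\<close>.\<close>

lemma ksub_spanned:
  assumes "finite A"
  shows "A \<subseteq> vcar V \<Longrightarrow> ksub V K \<Longrightarrow> K \<subseteq> kspan V A \<Longrightarrow>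
    \<exists>B. finite B \<and> B \<subseteq> K \<and> K \<subseteq> kspan V B"
  using assms
proof (induction A arbitrary: K rule: finite_induct)
  case empty
  then have "K \<subseteq> kspan V {} \<and> finite {} \<and> {} \<subseteq> K" by auto
  then show ?case by blast
next
  case (insert a A)
  have A: "A \<subseteq> vcar V" and a: "a \<in> vcar V" using insert.prems(1) by auto
  note K = ksubD[OF insert.prems(2)]
  have K': "ksub V (K \<inter> kspan V A)"
    unfolding ksub_def using K A by (auto intro: kspan_add kspan_scale kspan.zero)
  obtain B where B: "finite B" "B \<subseteq> K \<inter> kspan V A" "K \<inter> kspan V A \<subseteq> kspan V B"
    using insert.IH[OF A K'] by blast
  show ?case
  proof (cases "K \<subseteq> kspan V A")
    case True
    then show ?thesis using B by blast
  next
    case False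
    then obtain w where w: "w \<in> K" "w \<notin> kspan V A" by blast
    obtain c s where s: "s \<in> kspan V A" "w = vadd V (vscale V c a) s"
      using kspan_insertE[OF insert.prems(1)] insert.prems(3) w(1) by blast
    have sV: "s \<in> vcar V" using kspan_closed[OF A s(1)] .
    have c: "c \<noteq> 0"
      using w(2) s a sV by auto
    have "k \<in> kspan V (insert w B)" if k: "k \<in> K" for k
    proof -
      obtain d t where t: "t \<in> kspan V A" "k = vadd V (vscale V d a) t"
        using kspan_insertE[OF insert.prems(1)] insert.prems(3) k by blast
      have tV: "t \<in> vcar V" using kspan_closed[OF A t(1)] .
      \<comment> \<open>The multiple of \<open>w\<close> that has the same
        \<open>a\<close>-coefficient as \<open>k\<close>.\<close>
      define e where "e = d / c"
      define y where "y = vadd V (vscale V (- e) w) k"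
      have kV: "k \<in> vcar V" and wV: "w \<in> vcar V" using k w K by auto
      have "vadd V (vscale V (- e) w) k =
        vadd V (vadd V (vscale V (- d) a) (vscale V (- e) s)) (vadd V (vscale V d a) t)"
        using s(2) t(2) a sV c by (simp add: scale_add_right scale_scale e_def)
      also have "\<dots> = vadd V (vadd V (vscale V (- d) a) (vscale V d a)) (vadd V (vscale V (- e) s) t)"
        using a sV tV by (intro add_add_swap) auto
      also have "\<dots> = vadd V (vscale V (- e) s) t"
        using add_neg[OF a, of "- d"] sV tV by simp
      finally have "y \<in> kspan V A"
        using s(1) t(1) A by (auto simp: y_def intro: kspan_add kspan_scale)
      moreover have "y \<in> K"
        using k w K by (auto simp: y_def)
      ultimately have "y \<in> kspan V (insert w B)"
        using B(3) kspan_mono[of B "insert w B" V] by blast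
      then have "vadd V (vscale V e w) y \<in> kspan V (insert w B)"
        by (auto intro: kspan.step)
      moreover have "vadd V (vscale V e w) y = k"
        using add_neg[OF wV, of e] kV wV by (simp add: y_def flip: add_assoc)
      ultimately show ?thesis by simp
    qed
    then show ?thesis
      using B w(1) by (intro exI[of _ "insert w B"]) auto
  qed
qed

lemma ksub_fin_dim:
  assumes "fin_dim V" "ksub V K"
  shows "fin_dim (V\<lparr>vcar := K\<rparr>)"
proof -
  interpret W: kvspace "V\<lparr>vcar := K\<rparr>" using ksub_is_kvs[OF assms(2)] by unfold_locales
  obtain A where A: "finite A" "A \<subseteq> vcar V" "vcar V \<subseteq> kspan V A"
    using assms(1) unfolding fin_dim_iff by blast
  have "\<exists>B. finite B \<and> B \<subseteq> K \<and> K \<subseteq> kspan V B"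
    using ksub_spanned[OF A(1,2) assms(2)] A(3) ksubD(1)[OF assms(2)] by blast
  then show ?thesis
    unfolding W.fin_dim_iff by (simp add: kspan_restrict)
qed

section \<open>Cosets, quotients and induced maps\<close>

lemma coset_eq:
  assumes "ksub V B" "x \<in> vcar V" "b \<in> B"
  shows "coset V B (vadd V x b) = coset V B x"
proof (intro equalityI subsetI)
  note B = ksubD[OF assms(1)]
  fix z assume "z \<in> coset V B (vadd V x b)"
  then obtain b' where "b' \<in> B" "z = vadd V (vadd V x b) b'" by (auto simp: coset_def)
  then have "z = vadd V x (vadd V b b')" "vadd V b b' \<in> B"
    using assms B by (auto simp: add_assoc)
  then show "z \<in> coset V B x" by (auto simp: coset_def)
next
  note B = ksubD[OF assms(1)]
  fix z assume "z \<in> coset V B x"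
  then obtain b' where b': "b' \<in> B" "z = vadd V x b'" by (auto simp: coset_def)
  let ?n = "vscale V (- 1) b"
  have "vadd V b (vadd V ?n b') = b'"
    using add_neg[of b 1] assms(3) b' B(2) by (simp flip: add_assoc)
  then have "z = vadd V (vadd V x b) (vadd V ?n b')" "vadd V ?n b' \<in> B"
    using assms b' B by (auto simp: add_assoc)
  then show "z \<in> coset V B (vadd V x b)" by (auto simp: coset_def)
qed

text \<open>The operations on a quotient act on a representative picked by \<open>SOME\<close>; it
  differs from \<open>x\<close> by an element of \<open>B\<close>, which \<open>coset_eq\<close>
  then absorbs.\<close>

lemma some_in_coset:
  assumes "ksub V B" "x \<in> vcar V"
  obtains b where "b \<in> B" "(SOME y. y \<in> coset V B x) = vadd V x b"
proof -
  have "vadd V x (vzero V) \<in> coset V B x"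
    using ksubD[OF assms(1)] by (auto simp: coset_def)
  then have "(SOME y. y \<in> coset V B x) \<in> coset V B x" by (rule someI)
  then show thesis using that by (auto simp: coset_def)
qed

lemma quot_add:
  assumes "ksub V B" "x \<in> vcar V" "y \<in> vcar V"
  shows "vadd (quot_kvs V K B) (coset V B x) (coset V B y) = coset V B (vadd V x y)"
proof -
  note B = ksubD[OF assms(1)]
  obtain b where b: "b \<in> B" "(SOME y. y \<in> coset V B x) = vadd V x b"
    using some_in_coset[OF assms(1,2)] .
  obtain c where c: "c \<in> B" "(SOME z. z \<in> coset V B y) = vadd V y c"
    using some_in_coset[OF assms(1,3)] .
  have "vadd V (vadd V x b) (vadd V y c) = vadd V (vadd V x y) (vadd V b c)"
    using assms b c B by (intro add_add_swap) auto
  then show ?thesis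
    using coset_eq[OF assms(1), of "vadd V x y" "vadd V b c"] assms b c B
    by (simp add: quot_kvs_def)
qed

lemma quot_scale:
  assumes "ksub V B" "x \<in> vcar V"
  shows "vscale (quot_kvs V K B) c (coset V B x) = coset V B (vscale V c x)"
proof -
  note B = ksubD[OF assms(1)]
  obtain b where b: "b \<in> B" "(SOME y. y \<in> coset V B x) = vadd V x b"
    using some_in_coset[OF assms] .
  then show ?thesis
    using coset_eq[OF assms(1), of "vscale V c x" "vscale V c b"] assms b B
    by (simp add: quot_kvs_def scale_add_right)
qed

text \<open>Without \<open>B \<subseteq> K\<close> the quotient is still the image of \<open>K\<close> in \<open>V / B\<close>, so that the cohomology
  can be treated without first proving that the differential squares to zero.\<close>
lemma quot_is_kvs:
  assumes "ksub V K" "ksub V B"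
  shows "is_kvs (quot_kvs V K B)"
    and "fin_dim V \<Longrightarrow> fin_dim (quot_kvs V K B)"
proof -
  note K = ksubD[OF assms(1)]
  have lin: "klinear (V\<lparr>vcar := K\<rparr>) (quot_kvs V K B) (coset V B)"
    by (rule klinearI) (simp_all add: K quot_add[OF assms(2)] quot_scale[OF assms(2)],
        simp add: quot_kvs_def)
  show "is_kvs (quot_kvs V K B)"
    by (rule is_kvs_surj[OF ksub_is_kvs[OF assms(1)] lin]) (simp_all add: quot_kvs_def)
  show "fin_dim (quot_kvs V K B)" if "fin_dim V"
    by (rule fin_dim_surj[OF ksub_is_kvs[OF assms(1)] ksub_fin_dim[OF that assms(1)] lin])
      (simp_all add: quot_kvs_def)
qed

end

text \<open>The shape of \<open>loccoh_map\<close>, with \<open>cech_map\<close> abstracted to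
  \<open>f\<close>; the transport maps on cohomology have the same shape.\<close>

definition quot_map :: "('k, 'f) kvs \<Rightarrow> 'f set \<Rightarrow> ('e \<Rightarrow> 'f) \<Rightarrow> 'e set \<Rightarrow> 'f set" where
  "quot_map W B f A = coset W B (f (SOME x. x \<in> A))"

lemma quot_map_coset:
  assumes "is_kvs V" "is_kvs W" "klinear V W f" "ksub V B" "ksub W B'" "f ` B \<subseteq> B'" "x \<in> vcar V"
  shows "quot_map W B' f (coset V B x) = coset W B' (f x)"
proof -
  interpret V: kvspace V using assms by unfold_locales
  interpret W: kvspace W using assms by unfold_locales
  obtain b where b: "b \<in> B" "(SOME y. y \<in> coset V B x) = vadd V x b"
    using V.some_in_coset[OF assms(4,7)] .
  then have "f (vadd V x b) = vadd W (f x) (f b)" "f b \<in> B'"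
    using klinearD(2)[OF assms(3)] assms ksubD[OF assms(4)] by auto
  then show ?thesis
    using W.coset_eq[OF assms(5)] klinearD(1)[OF assms(3,7)] b(2) by (simp add: quot_map_def)
qed

lemma quot_map_klinear:
  assumes "is_kvs V" "is_kvs W" "klinear V W f" "ksub V B" "ksub W B'" "f ` B \<subseteq> B'"
    and "ksub V K" "ksub W K'" "f ` K \<subseteq> K'"
  shows "klinear (quot_kvs V K B) (quot_kvs W K' B') (quot_map W B' f)"
proof -
  interpret V: kvspace V using assms by unfold_locales
  interpret W: kvspace W using assms by unfold_locales
  note q = quot_map_coset[OF assms(1-6)]
  note K = ksubD[OF assms(7)]
  have car: "vcar (quot_kvs V K B) = coset V B ` K" "vcar (quot_kvs W K' B') = coset W B' ` K'"
    by (simp_all add: quot_kvs_def)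
  have fK: "f x \<in> K'" "f x \<in> vcar W" if "x \<in> K" for x
    using assms(9) that ksubD[OF assms(8)] by auto
  show ?thesis
    by (rule klinearI)
      (auto simp: car q K fK klinearD[OF assms(3)] V.quot_add[OF assms(4)] V.quot_scale[OF assms(4)]
        W.quot_add[OF assms(5)] W.quot_scale[OF assms(5)])
qed

section \<open>Finite products\<close>

text \<open>\<open>cech\<close> with its index sets and localizations abstracted. The fixed value
  outside \<open>J\<close> makes an element determined by its components.\<close>

definition pi_kvs :: "'s set \<Rightarrow> ('s \<Rightarrow> ('k, 'e) kvs) \<Rightarrow> ('k, 's \<Rightarrow> 'e) kvs" where
  "pi_kvs J W =
     \<lparr> vcar = {f. (\<forall>S\<in>J. f S \<in> vcar (W S)) \<and> (\<forall>S. S \<notin> J \<longrightarrow> f S = undefined)},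
       vzero = (\<lambda>S. if S \<in> J then vzero (W S) else undefined),
       vadd = (\<lambda>f g S. if S \<in> J then vadd (W S) (f S) (g S) else undefined),
       vscale = (\<lambda>c f S. if S \<in> J then vscale (W S) c (f S) else undefined) \<rparr>"

definition pi_map :: "'s set \<Rightarrow> ('s \<Rightarrow> 'e \<Rightarrow> 'f) \<Rightarrow> ('s \<Rightarrow> 'e) \<Rightarrow> 's \<Rightarrow> 'f" where
  "pi_map J F f = (\<lambda>S. if S \<in> J then F S (f S) else undefined)"

lemma pi_kvs_eqI:
  assumes "f \<in> vcar (pi_kvs J W)" "g \<in> vcar (pi_kvs J W)" "\<And>S. S \<in> J \<Longrightarrow> f S = g S"
  shows "f = g"
proof
  fix S show "f S = g S"
    using assms by (cases "S \<in> J") (auto simp: pi_kvs_def)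
qed

lemma pi_kvs_proj: "S \<in> J \<Longrightarrow> klinear (pi_kvs J W) (W S) (\<lambda>f. f S)"
  by (rule klinearI) (auto simp: pi_kvs_def)

lemma pi_kvs_is_kvs:
  assumes "\<And>S. S \<in> J \<Longrightarrow> is_kvs (W S)"
  shows "is_kvs (pi_kvs J W)"
proof -
  note [simp] = kvspace.zero_closed kvspace.add_closed kvspace.scale_closed
    kvspace.add_assoc kvspace.zero_left kvspace.scale_add_right
    kvspace.scale_add_left kvspace.scale_scale kvspace.scale_one
  have k: "kvspace (W S)" if "S \<in> J" for S
    using assms[OF that] by unfold_locales
  have "\<exists>g\<in>vcar (pi_kvs J W). vadd (pi_kvs J W) f g = vzero (pi_kvs J W)"
    if f: "f \<in> vcar (pi_kvs J W)" for f
  proof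
    show "vscale (pi_kvs J W) (- 1) f \<in> vcar (pi_kvs J W)"
      using f k by (auto simp: pi_kvs_def)
    show "vadd (pi_kvs J W) f (vscale (pi_kvs J W) (- 1) f) = vzero (pi_kvs J W)"
      using f k kvspace.add_neg[of "W S" "f S" 1 for S]
      by (auto simp: pi_kvs_def fun_eq_iff)
  qed
  then show ?thesis
    by (intro is_kvsI)
      (use k in \<open>auto simp: pi_kvs_def fun_eq_iff intro: kvspace.add_commute\<close>)
qed

lemma pi_map_klinear:
  assumes "\<And>S. S \<in> J \<Longrightarrow> klinear (V S) (W S) (F S)"
  shows "klinear (pi_kvs J V) (pi_kvs J W) (pi_map J F)"
  by (rule klinearI) (auto simp: pi_kvs_def pi_map_def fun_eq_iff klinearD[OF assms])

lemma klinear_into_pi: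
  assumes "\<And>S. S \<in> J \<Longrightarrow> klinear V (W S) (\<lambda>x. F x S)"
  shows "klinear V (pi_kvs J W) (\<lambda>x S. if S \<in> J then F x S else undefined)"
  by (rule klinearI) (auto simp: pi_kvs_def fun_eq_iff klinearD[OF assms])

lemma pi_kvs_fin_dim:
  assumes J: "finite J" and W: "\<And>S. S \<in> J \<Longrightarrow> is_kvs (W S)" and fd: "\<And>S. S \<in> J \<Longrightarrow> fin_dim (W S)"
  shows "fin_dim (pi_kvs J W)"
proof -
  let ?V = "pi_kvs J W"
  interpret V: kvspace ?V using pi_kvs_is_kvs[OF W] by unfold_locales
  have kW: "kvspace (W S)" if "S \<in> J" for S using W[OF that] by unfold_locales
  have "\<forall>S\<in>J. \<exists>A. finite A \<and> A \<subseteq> vcar (W S) \<and> vcar (W S) \<subseteq> kspan (W S) A"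
    using fd kW kvspace.fin_dim_iff by blast
  then obtain A where A: "\<And>S. S \<in> J \<Longrightarrow> finite (A S)" "\<And>S. S \<in> J \<Longrightarrow> A S \<subseteq> vcar (W S)"
    "\<And>S. S \<in> J \<Longrightarrow> vcar (W S) \<subseteq> kspan (W S) (A S)"
    by metis
  define e where "e S x = (\<lambda>T. if T \<in> J then (if T = S then x else vzero (W T)) else undefined)" for S x
  have e: "klinear (W S) ?V (e S)" if "S \<in> J" for S
    by (rule klinearI) (use kW in \<open>auto simp: e_def pi_kvs_def fun_eq_iff
        kvspace.zero_closed kvspace.zero_left kvspace.scale_zero_right\<close>)
  define E where "E = (\<Union>S\<in>J. e S ` A S)"
  have E: "finite E" "E \<subseteq> vcar ?V"
    using J A(1) A(2)[THEN subsetD] klinearD(1)[OF e] by (auto simp: E_def)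
  \<comment> \<open>Induction over a set \<open>T\<close> outside of which \<open>f\<close>
    vanishes: splitting off one component as \<open>e S (f S)\<close>, where \<open>e S\<close> is
    the inclusion of a factor, leaves an element with smaller support.\<close>
  have main: "f \<in> kspan ?V E" if "f \<in> vcar ?V" "finite T" "T \<subseteq> J"
    "\<And>S. S \<in> J - T \<Longrightarrow> f S = vzero (W S)" for f T
    using that(2,3,1,4)
  proof (induction T arbitrary: f rule: finite_induct)
    case empty
    then have "f = vzero ?V" by (intro pi_kvs_eqI[of f J W]) (auto simp: pi_kvs_def)
    then show ?case by (auto intro: kspan.zero)
  next
    case (insert S T)
    have S: "S \<in> J" using insert.prems by auto
    have fS: "f S \<in> vcar (W S)" using klinearD(1)[OF pi_kvs_proj[OF S] insert.prems(2)] .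
    define g where "g = f(S := vzero (W S))"
    have gV: "g \<in> vcar ?V"
      using insert.prems(2) S kvspace.zero_closed[OF kW] by (auto simp: g_def pi_kvs_def)
    have "g \<in> kspan ?V E"
      by (rule insert.IH[OF _ gV]) (use insert.prems insert.hyps in \<open>auto simp: g_def\<close>)
    moreover have "e S (f S) \<in> kspan ?V (e S ` A S)"
      by (rule kspan_image[OF e[OF S] W[OF S] klinear_zero[OF W[OF S] V.is_kvs e[OF S]] A(2)[OF S]])
        (use A(3)[OF S] fS in blast)
    then have "e S (f S) \<in> kspan ?V E"
      using kspan_mono[of "e S ` A S" E ?V] S by (auto simp: E_def)
    ultimately have "vadd ?V (e S (f S)) g \<in> kspan ?V E"
      using V.kspan_add[OF E(2)] by blast
    moreover have "vadd ?V (e S (f S)) g = f"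
      using insert.prems(2) S kW gV fS
      by (intro pi_kvs_eqI[of _ J W])
        (auto simp: klinearD(1)[OF e] e_def g_def pi_kvs_def
          kvspace.zero_left kvspace.zero_right kvspace.zero_closed)
    ultimately show ?case by simp
  qed
  show ?thesis
    unfolding V.fin_dim_iff using E main[OF _ J subset_refl] by blast
qed

section \<open>Transport along the regions of a subdivision\<close>

text \<open>The clauses of \<open>const_subdiv\<close> that speak of \<open>Q\<close> alone, to be
  shared by several modules.\<close>

definition region_partition :: "'v set set \<Rightarrow> 'v set \<Rightarrow> 'v set set \<Rightarrow> bool" where
  "region_partition X Q P \<longleftrightarrow> finite P \<and> P \<subseteq> X \<and> (\<forall>I\<in>P. I \<noteq> {}) \<and> \<Union>P = Q \<and>
     (\<forall>I\<in>P. \<forall>J\<in>P. I \<noteq> J \<longrightarrow> I \<inter> J = {})"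

text \<open>A cocycle of identifications between fibres, which can be given componentwise on
  products and passes to subquotients. In the last clause the pairs \<open>i, j\<close> and
  \<open>i', j'\<close> need not be comparable with each other; constancy of a subdivision demands
  this strength.\<close>

definition transport :: "'v::ab_group_add set set \<Rightarrow> 'v set \<Rightarrow> ('v \<Rightarrow> ('k::field, 'e) kvs) \<Rightarrow>
    ('v \<Rightarrow> 'v \<Rightarrow> 'e \<Rightarrow> 'e) \<Rightarrow> ('v \<Rightarrow> 'v \<Rightarrow> 'e \<Rightarrow> 'e) \<Rightarrow> bool" where
  "transport P Qp N np t \<longleftrightarrow>
     (\<forall>I\<in>P. \<forall>i\<in>I. \<forall>j\<in>I. klinear (N i) (N j) (t i j)) \<and>
     (\<forall>I\<in>P. \<forall>i\<in>I. \<forall>x\<in>vcar (N i). t i i x = x) \<and>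
     (\<forall>I\<in>P. \<forall>i\<in>I. \<forall>j\<in>I. \<forall>k\<in>I. \<forall>x\<in>vcar (N i). t j k (t i j x) = t i k x) \<and>
     (\<forall>I\<in>P. \<forall>J\<in>P. \<forall>i\<in>I. \<forall>j\<in>J. \<forall>i'\<in>I. \<forall>j'\<in>J. qle Qp i j \<longrightarrow> qle Qp i' j' \<longrightarrow>
        (\<forall>x\<in>vcar (N i). t j j' (np i j x) = np i' j' (t i i' x)))"

lemma transportD:
  assumes "transport P Qp N np t"
  shows "I \<in> P \<Longrightarrow> i \<in> I \<Longrightarrow> j \<in> I \<Longrightarrow> klinear (N i) (N j) (t i j)"
    and "I \<in> P \<Longrightarrow> i \<in> I \<Longrightarrow> x \<in> vcar (N i) \<Longrightarrow> t i i x = x"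
    and "I \<in> P \<Longrightarrow> i \<in> I \<Longrightarrow> j \<in> I \<Longrightarrow> k \<in> I \<Longrightarrow> x \<in> vcar (N i) \<Longrightarrow> t j k (t i j x) = t i k x"
    and "I \<in> P \<Longrightarrow> J \<in> P \<Longrightarrow> i \<in> I \<Longrightarrow> j \<in> J \<Longrightarrow> i' \<in> I \<Longrightarrow> j' \<in> J \<Longrightarrow> qle Qp i j \<Longrightarrow> qle Qp i' j' \<Longrightarrow>
      x \<in> vcar (N i) \<Longrightarrow> t j j' (np i j x) = np i' j' (t i i' x)"
proof -
  note t = assms[unfolded transport_def]
  show "I \<in> P \<Longrightarrow> i \<in> I \<Longrightarrow> j \<in> I \<Longrightarrow> klinear (N i) (N j) (t i j)"
    using t[THEN conjunct1] by blast
  show "I \<in> P \<Longrightarrow> i \<in> I \<Longrightarrow> x \<in> vcar (N i) \<Longrightarrow> t i i x = x"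
    using t[THEN conjunct2, THEN conjunct1] by blast
  show "I \<in> P \<Longrightarrow> i \<in> I \<Longrightarrow> j \<in> I \<Longrightarrow> k \<in> I \<Longrightarrow> x \<in> vcar (N i) \<Longrightarrow> t j k (t i j x) = t i k x"
    using t[THEN conjunct2, THEN conjunct2, THEN conjunct1] by blast
  show "I \<in> P \<Longrightarrow> J \<in> P \<Longrightarrow> i \<in> I \<Longrightarrow> j \<in> J \<Longrightarrow> i' \<in> I \<Longrightarrow> j' \<in> J \<Longrightarrow> qle Qp i j \<Longrightarrow> qle Qp i' j' \<Longrightarrow>
      x \<in> vcar (N i) \<Longrightarrow> t j j' (np i j x) = np i' j' (t i i' x)"
    using t[THEN conjunct2, THEN conjunct2, THEN conjunct2] by blast
qed

lemma transportI:
  assumes "\<And>I i j. I \<in> P \<Longrightarrow> i \<in> I \<Longrightarrow> j \<in> I \<Longrightarrow> klinear (N i) (N j) (t i j)"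
    and "\<And>I i x. I \<in> P \<Longrightarrow> i \<in> I \<Longrightarrow> x \<in> vcar (N i) \<Longrightarrow> t i i x = x"
    and "\<And>I i j k x. I \<in> P \<Longrightarrow> i \<in> I \<Longrightarrow> j \<in> I \<Longrightarrow> k \<in> I \<Longrightarrow> x \<in> vcar (N i) \<Longrightarrow>
      t j k (t i j x) = t i k x"
    and "\<And>I J i j i' j' x. I \<in> P \<Longrightarrow> J \<in> P \<Longrightarrow> i \<in> I \<Longrightarrow> j \<in> J \<Longrightarrow> i' \<in> I \<Longrightarrow> j' \<in> J \<Longrightarrow>
      qle Qp i j \<Longrightarrow> qle Qp i' j' \<Longrightarrow> x \<in> vcar (N i) \<Longrightarrow> t j j' (np i j x) = np i' j' (t i i' x)"
  shows "transport P Qp N np t"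
  unfolding transport_def by (intro conjI ballI impI) (fact assms)+

lemma is_qmodD:
  assumes "is_qmod Q Qp M mp"
  shows "q \<in> Q \<Longrightarrow> is_kvs (M q)"
    and "q \<in> Q \<Longrightarrow> q' \<in> Q \<Longrightarrow> qle Qp q q' \<Longrightarrow> klinear (M q) (M q') (mp q q')"
    and "q \<in> Q \<Longrightarrow> x \<in> vcar (M q) \<Longrightarrow> mp q q x = x"
    and "q \<in> Q \<Longrightarrow> q' \<in> Q \<Longrightarrow> q'' \<in> Q \<Longrightarrow> qle Qp q q' \<Longrightarrow> qle Qp q' q'' \<Longrightarrow> x \<in> vcar (M q) \<Longrightarrow>
      mp q' q'' (mp q q' x) = mp q q'' x"
proof -
  note k = assms[unfolded is_qmod_def]
  show "q \<in> Q \<Longrightarrow> is_kvs (M q)"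
    using k[THEN conjunct1] by blast
  show "q \<in> Q \<Longrightarrow> q' \<in> Q \<Longrightarrow> qle Qp q q' \<Longrightarrow> klinear (M q) (M q') (mp q q')"
    using k[THEN conjunct2, THEN conjunct1] by blast
  show "q \<in> Q \<Longrightarrow> x \<in> vcar (M q) \<Longrightarrow> mp q q x = x"
    using k[THEN conjunct2, THEN conjunct2, THEN conjunct1] by blast
  show "q \<in> Q \<Longrightarrow> q' \<in> Q \<Longrightarrow> q'' \<in> Q \<Longrightarrow> qle Qp q q' \<Longrightarrow> qle Qp q' q'' \<Longrightarrow> x \<in> vcar (M q) \<Longrightarrow>
      mp q' q'' (mp q q' x) = mp q q'' x"
    using k[THEN conjunct2, THEN conjunct2, THEN conjunct2] by blast
qed

lemma is_qmodI:
  assumes "\<And>q. q \<in> Q \<Longrightarrow> is_kvs (M q)"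
    and "\<And>q q'. q \<in> Q \<Longrightarrow> q' \<in> Q \<Longrightarrow> qle Qp q q' \<Longrightarrow> klinear (M q) (M q') (mp q q')"
    and "\<And>q x. q \<in> Q \<Longrightarrow> x \<in> vcar (M q) \<Longrightarrow> mp q q x = x"
    and "\<And>q q' q'' x. q \<in> Q \<Longrightarrow> q' \<in> Q \<Longrightarrow> q'' \<in> Q \<Longrightarrow> qle Qp q q' \<Longrightarrow> qle Qp q' q'' \<Longrightarrow>
      x \<in> vcar (M q) \<Longrightarrow> mp q' q'' (mp q q' x) = mp q q'' x"
  shows "is_qmod Q Qp M mp"
  unfolding is_qmod_def by (intro conjI ballI impI) (fact assms)+

definition rep :: "'v set \<Rightarrow> 'v" where
  "rep I = (SOME i. i \<in> I)"

lemma rep_in: "I \<noteq> {} \<Longrightarrow> rep I \<in> I"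
  unfolding rep_def by (simp add: some_in_eq)

lemma transport_const_subdiv:
  assumes P: "region_partition X Q P" and N: "is_qmod Q Qp N np" and t: "transport P Qp N np t"
  shows "const_subdiv X Q Qp N np P (\<lambda>I. N (rep I)) (\<lambda>I. t (rep I)) (\<lambda>I i. t i (rep I))"
proof -
  note tD = transportD[OF t]
  have inQ: "i \<in> Q" if "I \<in> P" "i \<in> I" for I i
    using P that unfolding region_partition_def by blast
  have rep: "rep I \<in> I" if "I \<in> P" for I
    using P that rep_in[of I] unfolding region_partition_def by simp
  have canon: "t j (rep J) (np i j (t (rep I) i x)) = t j' (rep J) (np i' j' (t (rep I) i' x))"
    if a: "I \<in> P" "J \<in> P" "i \<in> I" "j \<in> J" "i' \<in> I" "j' \<in> J" "qle Qp i j" "qle Qp i' j'"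
      "x \<in> vcar (N (rep I))" for I J i j i' j' x
  proof -
    let ?y = "t (rep I) i x"
    have y: "?y \<in> vcar (N i)"
      using klinearD(1)[OF tD(1)] a rep by blast
    then have z: "np i j ?y \<in> vcar (N j)"
      using klinearD(1)[OF is_qmodD(2)[OF N]] a inQ by blast
    \<comment> \<open>The cocycle rule routes \<open>rep I\<close> to \<open>i'\<close> through
      \<open>i\<close>; the commuting square then trades the structure map at \<open>i', j'\<close>
      for the one at \<open>i, j\<close>.\<close>
    have "t j' (rep J) (np i' j' (t (rep I) i' x)) = t j' (rep J) (np i' j' (t i i' ?y))"
      using tD(3)[of I "rep I" i i' x] a rep by simp
    also have "\<dots> = t j' (rep J) (t j j' (np i j ?y))"
      using tD(4)[of I J i j i' j' ?y] a y by simp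
    also have "\<dots> = t j (rep J) (np i j ?y)"
      using tD(3)[of J j j' "rep J"] a z rep by simp
    finally show ?thesis by simp
  qed
  have kvs: "is_kvs (N (rep I))" if "I \<in> P" for I
    using is_qmodD(1)[OF N] inQ rep that by blast
  have inv1: "t i (rep I) (t (rep I) i x) = x"
    if "I \<in> P" "i \<in> I" "x \<in> vcar (N (rep I))" for I i x
    using tD(2)[of I "rep I" x] tD(3)[of I "rep I" i "rep I" x] that rep by simp
  have inv2: "t (rep I) i (t i (rep I) x) = x" if "I \<in> P" "i \<in> I" "x \<in> vcar (N i)" for I i x
    using tD(2)[of I i x] tD(3)[of I i "rep I" i x] that rep by simp
  show ?thesis
    unfolding const_subdiv_def
  proof (intro conjI ballI impI)
    show "finite P" "P \<subseteq> X" "\<Union>P = Q"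
      using P unfolding region_partition_def by auto
    show "I \<noteq> {}" if "I \<in> P" for I
      using P that unfolding region_partition_def by auto
    show "I \<inter> J = {}" if "I \<in> P" "J \<in> P" "I \<noteq> J" for I J
      using P that unfolding region_partition_def by simp
  qed (assumption | rule tD(1) rep canon kvs inv1 inv2)+
qed

lemma transport_class_X_module:
  assumes "region_partition X Q P" "is_qmod Q Qp N np" "transport P Qp N np t"
    and "\<And>q. q \<in> Q \<Longrightarrow> fin_dim (N q)"
  shows "class_X_module X Q Qp N np"
  unfolding class_X_module_def using transport_const_subdiv[OF assms(1-3)] assms by blast

text \<open>The composite that must be independent of \<open>i\<close> equals
  \<open>f (rep I)\<close>: commuting with transport carries \<open>f i\<close> back to the chosen
  point.\<close>

lemma transport_class_X_hom:
  assumes P: "region_partition X Q P" and h: "is_qhom Q Qp N np N' np' f"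
    and t: "transport P Qp N np t" and t': "transport P Qp N' np' t'"
    and comm: "\<And>I i j x. I \<in> P \<Longrightarrow> i \<in> I \<Longrightarrow> j \<in> I \<Longrightarrow> x \<in> vcar (N i) \<Longrightarrow> f j (t i j x) = t' i j (f i x)"
  shows "class_X_hom X Q Qp N np N' np' f"
proof -
  have N: "is_qmod Q Qp N np" "is_qmod Q Qp N' np'"
    and fl: "\<And>q. q \<in> Q \<Longrightarrow> klinear (N q) (N' q) (f q)"
    using h unfolding is_qhom_def by auto
  have *: "t' i (rep I) (f i (t (rep I) i x)) = f (rep I) x"
    if "I \<in> P" "i \<in> I" "x \<in> vcar (N (rep I))" for I i x
  proof -
    have rep: "rep I \<in> I" "rep I \<in> Q"
      using P that rep_in[of I] unfolding region_partition_def by auto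
    have "f (rep I) x \<in> vcar (N' (rep I))"
      using klinearD(1)[OF fl] rep that by blast
    then show ?thesis
      using comm[of I "rep I" i x] transportD(3)[OF t', of I "rep I" i "rep I"]
        transportD(2)[OF t', of I "rep I"] that rep by simp
  qed
  show ?thesis
    unfolding class_X_hom_def
    by (intro conjI[OF h], rule exI[of _ P], rule exI[of _ "\<lambda>I. N (rep I)"],
        rule exI[of _ "\<lambda>I. t (rep I)"], rule exI[of _ "\<lambda>I i. t i (rep I)"],
        rule exI[of _ "\<lambda>I. N' (rep I)"], rule exI[of _ "\<lambda>I. t' (rep I)"],
        rule exI[of _ "\<lambda>I i. t' i (rep I)"])
      (intro conjI ballI transport_const_subdiv[OF P N(1) t] transport_const_subdiv[OF P N(2) t'],
        simp add: *)
qed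

section \<open>Subquotients of graded modules and of transports\<close>

lemma vcar_quot: "vcar (quot_kvs V K B) = coset V B ` K"
  by (simp add: quot_kvs_def)

lemma subquot_is_qmod:
  assumes N: "is_qmod Q Qp N np"
    and K: "\<And>q. q \<in> Q \<Longrightarrow> ksub (N q) (K q)" and B: "\<And>q. q \<in> Q \<Longrightarrow> ksub (N q) (B q)"
    and npK: "\<And>q q'. q \<in> Q \<Longrightarrow> q' \<in> Q \<Longrightarrow> qle Qp q q' \<Longrightarrow> np q q' ` K q \<subseteq> K q'"
    and npB: "\<And>q q'. q \<in> Q \<Longrightarrow> q' \<in> Q \<Longrightarrow> qle Qp q q' \<Longrightarrow> np q q' ` B q \<subseteq> B q'"
    and refl: "\<And>q. q \<in> Q \<Longrightarrow> qle Qp q q"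
    and trans: "\<And>q q' q''. q \<in> Q \<Longrightarrow> q' \<in> Q \<Longrightarrow> q'' \<in> Q \<Longrightarrow> qle Qp q q' \<Longrightarrow> qle Qp q' q'' \<Longrightarrow> qle Qp q q''"
  shows "is_qmod Q Qp (\<lambda>q. quot_kvs (N q) (K q) (B q)) (\<lambda>q q'. quot_map (N q') (B q') (np q q'))"
proof (rule is_qmodI)
  note ND = is_qmodD[OF N]
  have q: "quot_map (N q') (B q') (np q q') (coset (N q) (B q) x) = coset (N q') (B q') (np q q' x)"
    if "q \<in> Q" "q' \<in> Q" "qle Qp q q'" "x \<in> vcar (N q)" for q q' x
    using that by (intro quot_map_coset ND K B npB)
  show "is_kvs (quot_kvs (N q) (K q) (B q))" if "q \<in> Q" for q
    using kvspace.quot_is_kvs(1)[OF kvspace.intro[OF ND(1)]] K B that by blast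
  show "klinear (quot_kvs (N q) (K q) (B q)) (quot_kvs (N q') (K q') (B q'))
      (quot_map (N q') (B q') (np q q'))" if "q \<in> Q" "q' \<in> Q" "qle Qp q q'" for q q'
    using that by (intro quot_map_klinear ND K B npB npK)
  show "quot_map (N q) (B q) (np q q) A = A" if "q \<in> Q" "A \<in> vcar (quot_kvs (N q) (K q) (B q))" for q A
    using that by (auto simp: vcar_quot q refl ksubD(2)[OF K] ND(3))
  show "quot_map (N q'') (B q'') (np q' q'') (quot_map (N q') (B q') (np q q') A) =
      quot_map (N q'') (B q'') (np q q'') A"
    if "q \<in> Q" "q' \<in> Q" "q'' \<in> Q" "qle Qp q q'" "qle Qp q' q''"
      "A \<in> vcar (quot_kvs (N q) (K q) (B q))" for q q' q'' A
    using that trans[OF that(1-5)]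
    by (auto simp: vcar_quot q ksubD(2)[OF K] ND(4) klinearD(1)[OF ND(2)])
qed

text \<open>Transport respects the subspaces \<open>K\<close> and \<open>B\<close>, hence acts on
  cosets, and every required identity can be read off on representatives.\<close>

lemma subquot_transport:
  assumes N: "is_qmod Q Qp N np" and t: "transport P Qp N np t" and P: "\<Union>P = Q"
    and K: "\<And>q. q \<in> Q \<Longrightarrow> ksub (N q) (K q)" and B: "\<And>q. q \<in> Q \<Longrightarrow> ksub (N q) (B q)"
    and npB: "\<And>q q'. q \<in> Q \<Longrightarrow> q' \<in> Q \<Longrightarrow> qle Qp q q' \<Longrightarrow> np q q' ` B q \<subseteq> B q'"
    and tK: "\<And>I i j. I \<in> P \<Longrightarrow> i \<in> I \<Longrightarrow> j \<in> I \<Longrightarrow> t i j ` K i \<subseteq> K j"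
    and tB: "\<And>I i j. I \<in> P \<Longrightarrow> i \<in> I \<Longrightarrow> j \<in> I \<Longrightarrow> t i j ` B i \<subseteq> B j"
  shows "transport P Qp (\<lambda>q. quot_kvs (N q) (K q) (B q))
    (\<lambda>q q'. quot_map (N q') (B q') (np q q')) (\<lambda>q q'. quot_map (N q') (B q') (t q q'))"
proof (rule transportI)
  note ND = is_qmodD[OF N] and tD = transportD[OF t]
  have inQ: "i \<in> Q" if "I \<in> P" "i \<in> I" for I i using P that by blast
  have q: "quot_map (N q') (B q') (np q q') (coset (N q) (B q) x) = coset (N q') (B q') (np q q' x)"
    if "q \<in> Q" "q' \<in> Q" "qle Qp q q'" "x \<in> vcar (N q)" for q q' x
    using that by (intro quot_map_coset ND K B npB)
  have qt: "quot_map (N j) (B j) (t i j) (coset (N i) (B i) x) = coset (N j) (B j) (t i j x)"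
    if "I \<in> P" "i \<in> I" "j \<in> I" "x \<in> vcar (N i)" for I i j x
    using that by (intro quot_map_coset ND K B tB tD inQ)
  have tc: "t i j x \<in> vcar (N j)" if "I \<in> P" "i \<in> I" "j \<in> I" "x \<in> vcar (N i)" for I i j x
    using klinearD(1)[OF tD(1)] that by blast
  have Kc: "x \<in> vcar (N i)" if "I \<in> P" "i \<in> I" "x \<in> K i" for I i x
    using ksubD(2)[OF K] inQ that by blast
  show "klinear (quot_kvs (N i) (K i) (B i)) (quot_kvs (N j) (K j) (B j)) (quot_map (N j) (B j) (t i j))"
    if "I \<in> P" "i \<in> I" "j \<in> I" for I i j
    using that by (intro quot_map_klinear ND K B tB tK tD inQ)
  show "quot_map (N i) (B i) (t i i) A = A"
    if "I \<in> P" "i \<in> I" "A \<in> vcar (quot_kvs (N i) (K i) (B i))" for I i A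
    using that by (auto simp: vcar_quot qt Kc tD(2))
  show "quot_map (N k) (B k) (t j k) (quot_map (N j) (B j) (t i j) A) = quot_map (N k) (B k) (t i k) A"
    if "I \<in> P" "i \<in> I" "j \<in> I" "k \<in> I" "A \<in> vcar (quot_kvs (N i) (K i) (B i))" for I i j k A
    using that by (auto simp: vcar_quot qt Kc tc tD(3))
  show "quot_map (N j') (B j') (t j j') (quot_map (N j) (B j) (np i j) A) =
      quot_map (N j') (B j') (np i' j') (quot_map (N i') (B i') (t i i') A)"
    if "I \<in> P" "J \<in> P" "i \<in> I" "j \<in> J" "i' \<in> I" "j' \<in> J" "qle Qp i j" "qle Qp i' j'"
      and A: "A \<in> vcar (quot_kvs (N i) (K i) (B i))" for I J i j i' j' A
  proof -
    obtain x where x: "x \<in> K i" "A = coset (N i) (B i) x"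
      using A by (auto simp: vcar_quot)
    have "np i j x \<in> vcar (N j)"
      using klinearD(1)[OF ND(2)] inQ Kc x(1) that by blast
    then show ?thesis
      using that x Kc inQ tD(4)[of I J i j i' j' x] by (simp add: q qt tc)
  qed
qed

section \<open>Localization at a monomial\<close>

definition pt :: "'v::real_vector \<Rightarrow> 'v \<Rightarrow> nat \<Rightarrow> 'v" where
  "pt q p n = q + real n *\<^sub>R p"

lemma pt_0 [simp]: "pt q p 0 = q"
  by (simp add: pt_def)

text \<open>The canonical map \<open>M[x^{-p}]_q \<rightarrow> M[x^{-p'}]_{q'}\<close> for \<open>p \<preceq> p'\<close> and \<open>q \<preceq> q'\<close>, of which the
  structure maps of a localization and the changes of localization are the special cases
  \<open>p = p'\<close> and \<open>q = q'\<close>.\<close>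
definition loc_canon :: "('v::real_vector \<Rightarrow> ('k, 'e) kvs) \<Rightarrow> ('v \<Rightarrow> 'v \<Rightarrow> 'e \<Rightarrow> 'e) \<Rightarrow>
    'v \<Rightarrow> 'v \<Rightarrow> 'v \<Rightarrow> 'v \<Rightarrow> (nat \<times> 'e) set \<Rightarrow> (nat \<times> 'e) set" where
  "loc_canon M mp p p' q q' A = (let a = (SOME a. a \<in> A) in
     lcls M mp p' q' (fst a, mp (pt q p (fst a)) (pt q' p' (fst a)) (snd a)))"

lemma loc_map_canon: "loc_map M mp p q q' = loc_canon M mp p p q q'"
  by (simp add: fun_eq_iff loc_map_def loc_canon_def pt_def)

lemma loc_change_canon: "loc_change M mp p p' q = loc_canon M mp p p' q q"
  by (simp add: fun_eq_iff loc_change_def loc_canon_def pt_def)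

locale po_module =
  fixes Q Qp :: "'v::euclidean_space set"
    and M :: "'v \<Rightarrow> ('k::field, 'e) kvs" and mp :: "'v \<Rightarrow> 'v \<Rightarrow> 'e \<Rightarrow> 'e"
  assumes po: "po_group Q Qp" and qmod: "is_qmod Q Qp M mp"
begin

abbreviation le (infix "\<preceq>" 50) where "a \<preceq> b \<equiv> qle Qp a b"

lemma Q_add [simp]: "a \<in> Q \<Longrightarrow> b \<in> Q \<Longrightarrow> a + b \<in> Q"
  and Qp_Q: "a \<in> Qp \<Longrightarrow> a \<in> Q"
  and Qp_0 [simp]: "0 \<in> Qp"
  and Qp_add [simp]: "a \<in> Qp \<Longrightarrow> b \<in> Qp \<Longrightarrow> a + b \<in> Qp"
  using po unfolding po_group_def by auto

lemma Qp_scale [simp]: "p \<in> Qp \<Longrightarrow> real n *\<^sub>R p \<in> Qp"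
  by (induction n) (auto simp: algebra_simps)

lemma qle_refl [simp]: "a \<preceq> a"
  by (simp add: qle_def)

lemma qle_trans: "a \<preceq> b \<Longrightarrow> b \<preceq> c \<Longrightarrow> a \<preceq> c"
  using Qp_add[of "b - a" "c - b"] by (simp add: qle_def)

lemma pt_in [simp]: "q \<in> Q \<Longrightarrow> p \<in> Qp \<Longrightarrow> pt q p n \<in> Q"
  by (simp add: pt_def Qp_Q)

lemma pt_le [simp]: "p \<in> Qp \<Longrightarrow> n \<le> m \<Longrightarrow> pt q p n \<preceq> pt q p m"
  using Qp_scale[of p "m - n"] by (simp add: qle_def pt_def of_nat_diff scaleR_diff_left)

lemma le_pt [simp]: "p \<in> Qp \<Longrightarrow> q \<preceq> pt q p n"
  using pt_le[of p 0 n q] by simp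

lemma pt_mono: "q \<preceq> q' \<Longrightarrow> p \<preceq> p' \<Longrightarrow> pt q p n \<preceq> pt q' p' n"
proof -
  assume "q \<preceq> q'" "p \<preceq> p'"
  then have "(q' - q) + real n *\<^sub>R (p' - p) \<in> Qp" by (simp add: qle_def)
  also have "(q' - q) + real n *\<^sub>R (p' - p) = pt q' p' n - pt q p n"
    by (simp add: pt_def scaleR_diff_right)
  finally show ?thesis by (simp add: qle_def)
qed

lemmas M_kvs = is_qmodD(1)[OF qmod]
  and mp_lin = is_qmodD(2)[OF qmod]
  and mp_id = is_qmodD(3)[OF qmod]
  and mp_comp = is_qmodD(4)[OF qmod]
  and mp_closed = klinearD(1)[OF is_qmodD(2)[OF qmod]]

abbreviation "cls p q n x \<equiv> lcls M mp p q (n, x)"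
abbreviation "loc p q \<equiv> loc_kvs M mp p q"
abbreviation "Mpt p q n \<equiv> vcar (M (pt q p n))"
abbreviation "push p q n m \<equiv> mp (pt q p n) (pt q p m)"

context
  fixes p q assumes p: "p \<in> Qp" and q: "q \<in> Q"
begin

lemma push_closed [simp]: "n \<le> m \<Longrightarrow> x \<in> Mpt p q n \<Longrightarrow> push p q n m x \<in> Mpt p q m"
  using mp_closed p q by simp

lemma push_push [simp]:
  "n \<le> m \<Longrightarrow> m \<le> k \<Longrightarrow> x \<in> Mpt p q n \<Longrightarrow> push p q m k (push p q n m x) = push p q n k x"
  using mp_comp p q by simp

lemma push_lin: "n \<le> m \<Longrightarrow> klinear (M (pt q p n)) (M (pt q p m)) (push p q n m)"
  using mp_lin p q by simp

lemma lpairs_iff: "(n, x) \<in> lpairs M p q \<longleftrightarrow> x \<in> Mpt p q n"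
  by (simp add: lpairs_def pt_def)

text \<open>Equality at one common stage persists at all later ones, so the particular stages
  \<open>n + m + k\<close> of the definition can be exchanged for arbitrary common stages.\<close>

lemma lrel_iff:
  assumes "x \<in> Mpt p q n" "y \<in> Mpt p q m"
  shows "lrel M mp p q (n, x) (m, y) \<longleftrightarrow> (\<exists>N. n \<le> N \<and> m \<le> N \<and> push p q n N x = push p q m N y)"
proof -
  have "lrel M mp p q (n, x) (m, y) \<longleftrightarrow> (\<exists>k. push p q n (n + m + k) x = push p q m (n + m + k) y)"
    using assms unfolding lrel_def lpairs_iff fst_conv snd_conv pt_def by simp
  also have "\<dots> \<longleftrightarrow> (\<exists>N. n \<le> N \<and> m \<le> N \<and> push p q n N x = push p q m N y)"
  proof
    assume "\<exists>k. push p q n (n + m + k) x = push p q m (n + m + k) y"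
    then obtain k where "push p q n (n + m + k) x = push p q m (n + m + k) y" by blast
    then show "\<exists>N. n \<le> N \<and> m \<le> N \<and> push p q n N x = push p q m N y"
      by (intro exI[of _ "n + m + k"]) simp
  next
    assume "\<exists>N. n \<le> N \<and> m \<le> N \<and> push p q n N x = push p q m N y"
    then obtain N where N: "n \<le> N" "m \<le> N" "push p q n N x = push p q m N y" by blast
    then have "push p q N (n + m + N) (push p q n N x) = push p q N (n + m + N) (push p q m N y)"
      by simp
    then have "push p q n (n + m + N) x = push p q m (n + m + N) y"
      using assms N(1,2) by simp
    then show "\<exists>k. push p q n (n + m + k) x = push p q m (n + m + k) y" by blast
  qed
  finally show ?thesis .
qed

lemma lrel_car: "lrel M mp p q a b \<Longrightarrow> snd a \<in> Mpt p q (fst a) \<and> snd b \<in> Mpt p q (fst b)"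
  unfolding lrel_def using lpairs_iff[of "fst a" "snd a"] lpairs_iff[of "fst b" "snd b"] by simp

text \<open>Because the equality holds at every late stage, several relations can be evaluated at
  one stage.\<close>

lemma lrel_far:
  assumes "lrel M mp p q (n, x) (m, y)"
  obtains N where "n \<le> N" "m \<le> N" "\<forall>K\<ge>N. push p q n K x = push p q m K y"
proof -
  have xy: "x \<in> Mpt p q n" "y \<in> Mpt p q m" using lrel_car[OF assms] by auto
  obtain N where N: "n \<le> N" "m \<le> N" "push p q n N x = push p q m N y"
    using assms lrel_iff[OF xy] by blast
  have "push p q n K x = push p q m K y" if "N \<le> K" for K
  proof -
    have "push p q N K (push p q n N x) = push p q N K (push p q m N y)" using N by simp
    then show ?thesis using N(1,2) xy that by simp
  qed
  then show thesis using that N by blast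
qed

lemma lrel_refl: "x \<in> Mpt p q n \<Longrightarrow> lrel M mp p q (n, x) (n, x)"
  using lrel_iff by blast

lemma lrel_sym: "lrel M mp p q a b \<Longrightarrow> lrel M mp p q b a"
  using lrel_car[of a b] lrel_iff[of "snd a" "fst a" "snd b" "fst b"]
    lrel_iff[of "snd b" "fst b" "snd a" "fst a"] by (auto 0 3)

lemma lrel_trans:
  assumes "lrel M mp p q a b" "lrel M mp p q b c"
  shows "lrel M mp p q a c"
proof -
  obtain n x m y k z where abc: "a = (n, x)" "b = (m, y)" "c = (k, z)"
    by (cases a, cases b, cases c) auto
  have car: "x \<in> Mpt p q n" "y \<in> Mpt p q m" "z \<in> Mpt p q k"
    using lrel_car[OF assms(1)] lrel_car[OF assms(2)] abc by auto
  obtain N where N: "n \<le> N" "m \<le> N" "\<forall>K\<ge>N. push p q n K x = push p q m K y"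
    using lrel_far assms(1) abc by blast
  obtain N' where N': "m \<le> N'" "k \<le> N'" "\<forall>K\<ge>N'. push p q m K y = push p q k K z"
    using lrel_far assms(2) abc by blast
  show ?thesis
    unfolding abc lrel_iff[OF car(1,3)]
    using N N' by (intro exI[of _ "N + N'"]) simp
qed

lemma cls_eq_iff_lrel:
  assumes "x \<in> Mpt p q n"
  shows "cls p q n x = cls p q m y \<longleftrightarrow> lrel M mp p q (n, x) (m, y)"
proof
  assume "cls p q n x = cls p q m y"
  then have "(n, x) \<in> cls p q m y" using lrel_refl[OF assms] unfolding lcls_def by blast
  then show "lrel M mp p q (n, x) (m, y)" unfolding lcls_def by (blast intro: lrel_sym)
next
  assume "lrel M mp p q (n, x) (m, y)"
  then show "cls p q n x = cls p q m y"
    unfolding lcls_def by (blast intro: lrel_sym lrel_trans)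
qed

lemma cls_eqI:
  assumes "x \<in> Mpt p q n" "y \<in> Mpt p q m" "n \<le> N" "m \<le> N" "push p q n N x = push p q m N y"
  shows "cls p q n x = cls p q m y"
  using assms cls_eq_iff_lrel lrel_iff by blast

lemma cls_eq_far:
  assumes "x \<in> Mpt p q n" "cls p q n x = cls p q m y"
  obtains N where "n \<le> N" "m \<le> N" "\<forall>K\<ge>N. push p q n K x = push p q m K y"
  using assms cls_eq_iff_lrel lrel_far by blast

lemma cls_push:
  assumes "x \<in> Mpt p q n" "n \<le> m"
  shows "cls p q m (push p q n m x) = cls p q n x"
  by (rule cls_eqI[of _ _ _ _ m]) (use assms p q mp_id[of "pt q p m"] in simp_all)

lemma some_cls:
  assumes "x \<in> Mpt p q n"
  obtains m y where "(SOME a. a \<in> cls p q n x) = (m, y)" "y \<in> Mpt p q m"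
    "cls p q n x = cls p q m y"
proof -
  have "(n, x) \<in> cls p q n x" using lrel_refl[OF assms] by (simp add: lcls_def)
  then have "(SOME a. a \<in> cls p q n x) \<in> cls p q n x" by (rule someI)
  moreover obtain m y where my: "(SOME a. a \<in> cls p q n x) = (m, y)" by fastforce
  ultimately have "lrel M mp p q (n, x) (m, y)" by (simp add: lcls_def)
  then show thesis
    using that[OF my] lrel_car cls_eq_iff_lrel[OF assms] by fastforce
qed

lemma loc_car: "vcar (loc p q) = {cls p q n x | n x. x \<in> Mpt p q n}"
proof -
  have "vcar (loc p q) = lcls M mp p q ` lpairs M p q" by (simp add: loc_kvs_def)
  then show ?thesis using lpairs_iff by fastforce
qed

lemma loc_zero: "vzero (loc p q) = cls p q 0 (vzero (M q))"
  by (simp add: loc_kvs_def)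

text \<open>The record adds whatever representatives \<open>SOME\<close> picks. Far enough out these
  agree with the given ones, so elements at a common stage can be added in \<open>M\<close>.\<close>

lemma loc_add:
  assumes "x \<in> Mpt p q n" "y \<in> Mpt p q n"
  shows "vadd (loc p q) (cls p q n x) (cls p q n y) = cls p q n (vadd (M (pt q p n)) x y)"
proof -
  obtain a x' where a: "(SOME a. a \<in> cls p q n x) = (a, x')" "x' \<in> Mpt p q a"
    "cls p q n x = cls p q a x'" using some_cls[OF assms(1)] .
  obtain b y' where b: "(SOME a. a \<in> cls p q n y) = (b, y')" "y' \<in> Mpt p q b"
    "cls p q n y = cls p q b y'" using some_cls[OF assms(2)] .
  obtain N1 where N1: "n \<le> N1" "a \<le> N1" "\<forall>K\<ge>N1. push p q n K x = push p q a K x'"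
    using cls_eq_far[OF assms(1) a(3)] .
  obtain N2 where N2: "n \<le> N2" "b \<le> N2" "\<forall>K\<ge>N2. push p q n K y = push p q b K y'"
    using cls_eq_far[OF assms(2) b(3)] .
  define s where "s = vadd (M (pt q p (a + b))) (push p q a (a + b) x') (push p q b (a + b) y')"
  \<comment> \<open>\<open>N1\<close> dominates \<open>a\<close> and \<open>N2\<close> dominates
    \<open>b\<close>, so this stage also lies beyond \<open>a + b\<close>, where the definition
    performs the addition.\<close>
  define N where "N = N1 + N2"
  have N: "n \<le> N" "a + b \<le> N" using N1 N2 by (auto simp: N_def)
  have kvs: "kvspace (M (pt q p m))" for m
    using p q by (intro kvspace.intro M_kvs pt_in)
  have "vadd (loc p q) (cls p q n x) (cls p q n y) = cls p q (a + b) s"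
    unfolding loc_kvs_def a(1) b(1) by (simp add: a(1) b(1) Let_def s_def pt_def)
  also have "\<dots> = cls p q n (vadd (M (pt q p n)) x y)"
  proof (rule cls_eqI[of _ _ _ _ N])
    show "s \<in> Mpt p q (a + b)"
      unfolding s_def using a b by (intro kvspace.add_closed[OF kvs] push_closed) auto
    show "vadd (M (pt q p n)) x y \<in> Mpt p q n"
      using assms by (intro kvspace.add_closed[OF kvs])
    have "push p q (a + b) N s = vadd (M (pt q p N)) (push p q a N x') (push p q b N y')"
      unfolding s_def using a(2) b(2) N by (simp add: klinearD(2)[OF push_lin])
    also have "\<dots> = push p q n N (vadd (M (pt q p n)) x y)"
      using N1(3) N2(3) assms N by (simp add: klinearD(2)[OF push_lin] N_def)
    finally show "push p q (a + b) N s = push p q n N (vadd (M (pt q p n)) x y)" .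
  qed (fact N)+
  finally show ?thesis .
qed

lemma loc_scale:
  assumes "x \<in> Mpt p q n"
  shows "vscale (loc p q) c (cls p q n x) = cls p q n (vscale (M (pt q p n)) c x)"
proof -
  obtain a x' where a: "(SOME a. a \<in> cls p q n x) = (a, x')" "x' \<in> Mpt p q a"
    "cls p q n x = cls p q a x'" using some_cls[OF assms(1)] .
  obtain N where N: "n \<le> N" "a \<le> N" "\<forall>K\<ge>N. push p q n K x = push p q a K x'"
    using cls_eq_far[OF assms(1) a(3)] .
  have kvs: "kvspace (M (pt q p m))" for m
    using p q by (intro kvspace.intro M_kvs pt_in)
  have "vscale (loc p q) c (cls p q n x) = cls p q a (vscale (M (pt q p a)) c x')"
    by (simp add: loc_kvs_def a(1) pt_def)
  also have "\<dots> = cls p q n (vscale (M (pt q p n)) c x)"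
    by (rule cls_eqI[of _ _ _ _ N])
      (use N a(2) assms in \<open>simp_all add: kvspace.scale_closed[OF kvs] klinearD(3)[OF push_lin]\<close>)
  finally show ?thesis .
qed

end

text \<open>The structure maps from one chain to the other commute with pushing to later stages, so
  the result does not depend on the representative that \<open>SOME\<close> picks.\<close>

lemma loc_canon_cls:
  assumes p: "p \<in> Qp" and q: "q \<in> Q" and p': "p' \<in> Qp" and q': "q' \<in> Q" and le: "q \<preceq> q'" "p \<preceq> p'"
    and x: "x \<in> Mpt p q n"
  shows "loc_canon M mp p p' q q' (cls p q n x) = cls p' q' n (mp (pt q p n) (pt q' p' n) x)"
proof -
  obtain a x' where a: "(SOME a. a \<in> cls p q n x) = (a, x')" "x' \<in> Mpt p q a"
    "cls p q n x = cls p q a x'" using some_cls[OF p q x] .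
  obtain N where N: "n \<le> N" "a \<le> N" "\<forall>K\<ge>N. push p q n K x = push p q a K x'"
    using cls_eq_far[OF p q x a(3)] .
  have m: "pt q p m \<preceq> pt q' p' m" for m using pt_mono le by simp
  have nat: "push p' q' m N (mp (pt q p m) (pt q' p' m) z) = mp (pt q p N) (pt q' p' N) (push p q m N z)"
    if "z \<in> Mpt p q m" "m \<le> N" for m z
    using that p q p' q' m by (simp add: mp_comp qle_trans[OF m pt_le] qle_trans[OF pt_le m])
  have "loc_canon M mp p p' q q' (cls p q n x) = cls p' q' a (mp (pt q p a) (pt q' p' a) x')"
    by (simp add: loc_canon_def a(1))
  also have "\<dots> = cls p' q' n (mp (pt q p n) (pt q' p' n) x)"
    by (rule cls_eqI[OF p' q', of _ _ _ _ N])
      (use N a(2) x p q p' q' m in \<open>simp_all add: nat mp_closed\<close>)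
  finally show ?thesis .
qed

end

section \<open>Localizations of modules with a constant subdivision\<close>

locale subdivided_module = po_module Q Qp M mp
  for Q Qp :: "'v::euclidean_space set" and M :: "'v \<Rightarrow> ('k::field, 'e) kvs" and mp +
  fixes X :: "'v set set" and P :: "'v set set" and MI phi psi
  assumes subdiv: "const_subdiv X Q Qp M mp P MI phi psi"
    and M_fin_dim: "\<And>q. q \<in> Q \<Longrightarrow> fin_dim (M q)"
begin

lemma region_Q: "I \<in> P \<Longrightarrow> a \<in> I \<Longrightarrow> a \<in> Q"
  and region_ne: "I \<in> P \<Longrightarrow> I \<noteq> {}"
  and regions: "finite P" "P \<subseteq> X" "\<Union>P = Q"
  using subdiv unfolding const_subdiv_def by auto

lemma MI_kvs: "I \<in> P \<Longrightarrow> is_kvs (MI I)"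
  and phi_lin: "I \<in> P \<Longrightarrow> a \<in> I \<Longrightarrow> klinear (MI I) (M a) (phi I a)"
  and psi_lin: "I \<in> P \<Longrightarrow> a \<in> I \<Longrightarrow> klinear (M a) (MI I) (psi I a)"
  and psi_phi [simp]: "I \<in> P \<Longrightarrow> a \<in> I \<Longrightarrow> x \<in> vcar (MI I) \<Longrightarrow> psi I a (phi I a x) = x"
  and phi_psi [simp]: "I \<in> P \<Longrightarrow> a \<in> I \<Longrightarrow> y \<in> vcar (M a) \<Longrightarrow> phi I a (psi I a y) = y"
proof -
  have *: "\<forall>I\<in>P. is_kvs (MI I) \<and>
        (\<forall>i\<in>I. klinear (MI I) (M i) (phi I i) \<and> klinear (M i) (MI I) (psi I i) \<and>
           (\<forall>x\<in>vcar (MI I). psi I i (phi I i x) = x) \<and>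
           (\<forall>y\<in>vcar (M i). phi I i (psi I i y) = y))"
    using subdiv unfolding const_subdiv_def by (elim conjE)
  show "I \<in> P \<Longrightarrow> is_kvs (MI I)"
    "I \<in> P \<Longrightarrow> a \<in> I \<Longrightarrow> klinear (MI I) (M a) (phi I a)"
    "I \<in> P \<Longrightarrow> a \<in> I \<Longrightarrow> klinear (M a) (MI I) (psi I a)"
    "I \<in> P \<Longrightarrow> a \<in> I \<Longrightarrow> x \<in> vcar (MI I) \<Longrightarrow> psi I a (phi I a x) = x"
    "I \<in> P \<Longrightarrow> a \<in> I \<Longrightarrow> y \<in> vcar (M a) \<Longrightarrow> phi I a (psi I a y) = y"
    using * by simp_all
qed

lemmas phi_closed = klinearD(1)[OF phi_lin] and psi_closed = klinearD(1)[OF psi_lin]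

lemma subdiv_const:
  assumes "I \<in> P" "J \<in> P" "i \<in> I" "j \<in> J" "i' \<in> I" "j' \<in> J" "i \<preceq> j" "i' \<preceq> j'" "x \<in> vcar (MI I)"
  shows "psi J j (mp i j (phi I i x)) = psi J j' (mp i' j' (phi I i' x))"
proof -
  have "\<forall>I\<in>P. \<forall>J\<in>P. \<forall>i\<in>I. \<forall>j\<in>J. \<forall>i'\<in>I. \<forall>j'\<in>J.
        qle Qp i j \<longrightarrow> qle Qp i' j' \<longrightarrow>
        (\<forall>x\<in>vcar (MI I). psi J j (mp i j (phi I i x)) = psi J j' (mp i' j' (phi I i' x)))"
    using subdiv unfolding const_subdiv_def by (elim conjE)
  then show ?thesis using assms by blast
qed

text \<open>Constancy, compared with the trivial relation \<open>i \<preceq> i\<close>, makes \<open>M_i \<rightarrow> M_j\<close> an isomorphism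
  whenever \<open>i \<preceq> j\<close> lie in the same region.\<close>
lemma mp_phi:
  assumes "I \<in> P" "i \<in> I" "j \<in> I" "i \<preceq> j" "x \<in> vcar (MI I)"
  shows "mp i j (phi I i x) = phi I j x"
proof -
  have c: "phi I i x \<in> vcar (M i)" "mp i j (phi I i x) \<in> vcar (M j)"
    using assms region_Q by (simp_all add: phi_closed mp_closed)
  have "psi I j (mp i j (phi I i x)) = psi I i (mp i i (phi I i x))"
    using assms by (intro subdiv_const) auto
  also have "\<dots> = x"
    using assms c region_Q by (simp add: mp_id)
  finally have "phi I j (psi I j (mp i j (phi I i x))) = phi I j x" by simp
  then show ?thesis using assms c by simp
qed

text \<open>Points of \<open>I\<close> interleave with the chain \<open>pt q p n\<close>, so both
  compute the same direct limit. They may lie off the chain, since the returns to \<open>I\<close>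
  are found in a cone with several generators.\<close>

definition cofinal :: "'v set \<Rightarrow> 'v \<Rightarrow> 'v \<Rightarrow> bool" where
  "cofinal I p q \<longleftrightarrow> (\<forall>n. \<exists>a\<in>I. \<exists>k\<ge>n. pt q p n \<preceq> a \<and> a \<preceq> pt q p k)"

text \<open>The isomorphism \<open>M_I \<rightarrow> M[x^{-p}]_q\<close>, provided that \<open>I\<close> is cofinal at \<open>q\<close>; the value does not
  depend on the choice of \<open>a\<close> and \<open>k\<close>.\<close>
definition sg :: "'v set \<Rightarrow> 'v \<Rightarrow> 'v \<Rightarrow> 'e \<Rightarrow> (nat \<times> 'e) set" where
  "sg I p q x = (let (a, k) = (SOME (a, k). a \<in> I \<and> q \<preceq> a \<and> a \<preceq> pt q p k)
     in cls p q k (mp a (pt q p k) (phi I a x)))"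

context
  fixes I p q assumes I: "I \<in> P" and p: "p \<in> Qp" and q: "q \<in> Q" and cof: "cofinal I p q"
begin

text \<open>Compare through a point \<open>b\<close> of \<open>I\<close> beyond stage
  \<open>k\<close>: inside \<open>I\<close> the structure map from \<open>a\<close> to
  \<open>b\<close> turns \<open>phi I a x\<close> into \<open>phi I b x\<close>, so starting at
  \<open>a\<close> or at \<open>b\<close> gives the same element at stage \<open>m\<close>.\<close>

lemma sg_far:
  assumes x: "x \<in> vcar (MI I)" and a: "a \<in> I" "a \<preceq> pt q p k"
    and b: "b \<in> I" "k \<le> n" "pt q p n \<preceq> b" "b \<preceq> pt q p m" "n \<le> m"
  shows "push p q k m (mp a (pt q p k) (phi I a x)) = mp b (pt q p m) (phi I b x)"
proof -
  have Q: "a \<in> Q" "b \<in> Q" using a b I region_Q by auto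
  have fx: "phi I a x \<in> vcar (M a)" using phi_closed I a x by blast
  have ab: "a \<preceq> b"
    using qle_trans[OF qle_trans[OF a(2) pt_le[OF p b(2)]] b(3)] .
  have am: "a \<preceq> pt q p m" using qle_trans[OF ab b(4)] .
  have "push p q k m (mp a (pt q p k) (phi I a x)) = mp a (pt q p m) (phi I a x)"
    using Q p q a b fx by (intro mp_comp) auto
  also have "\<dots> = mp b (pt q p m) (mp a b (phi I a x))"
    using Q p q ab b fx by (intro mp_comp[symmetric]) auto
  also have "mp a b (phi I a x) = phi I b x"
    using mp_phi I a b ab x by blast
  finally show ?thesis .
qed

lemma sg_rep_eq:
  assumes x: "x \<in> vcar (MI I)" and a: "a \<in> I" "a \<preceq> pt q p k" and b: "b \<in> I" "b \<preceq> pt q p l"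
  shows "cls p q k (mp a (pt q p k) (phi I a x)) = cls p q l (mp b (pt q p l) (phi I b x))"
proof -
  obtain c m where c: "c \<in> I" "k + l \<le> m" "pt q p (k + l) \<preceq> c" "c \<preceq> pt q p m"
    using cof unfolding cofinal_def by blast
  show ?thesis
    by (rule cls_eqI[OF p q, of _ _ _ _ m])
      (use sg_far[OF x a c(1) _ c(3,4,2)] sg_far[OF x b c(1) _ c(3,4,2)] c a b x I p q region_Q
        in \<open>auto simp: mp_closed phi_closed\<close>)
qed

lemma sg_eq:
  assumes x: "x \<in> vcar (MI I)" and a: "a \<in> I" "q \<preceq> a" "a \<preceq> pt q p k"
  shows "sg I p q x = cls p q k (mp a (pt q p k) (phi I a x))"
proof -
  obtain b l where bl: "(SOME (a, k). a \<in> I \<and> q \<preceq> a \<and> a \<preceq> pt q p k) = (b, l)"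
    by (meson surj_pair)
  have "case (SOME (a, k). a \<in> I \<and> q \<preceq> a \<and> a \<preceq> pt q p k) of (a, k) \<Rightarrow> a \<in> I \<and> q \<preceq> a \<and> a \<preceq> pt q p k"
    by (rule someI[of _ "(a, k)"]) (use a in simp)
  then have "b \<in> I" "b \<preceq> pt q p l" by (simp_all add: bl)
  then show ?thesis
    unfolding sg_def bl Let_def prod.case by (intro sg_rep_eq x a)
qed

lemma sg_rep:
  obtains a k where "a \<in> I" "q \<preceq> a" "a \<preceq> pt q p k"
    "a \<in> Q" "\<And>x. x \<in> vcar (MI I) \<Longrightarrow> mp a (pt q p k) (phi I a x) \<in> Mpt p q k"
    "\<And>x. x \<in> vcar (MI I) \<Longrightarrow> sg I p q x = cls p q k (mp a (pt q p k) (phi I a x))"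
proof -
  obtain a k where a: "a \<in> I" "q \<preceq> a" "a \<preceq> pt q p k"
    using cof unfolding cofinal_def by (metis pt_0)
  have aQ: "a \<in> Q" using region_Q I a by blast
  have c: "mp a (pt q p k) (phi I a x) \<in> Mpt p q k" if "x \<in> vcar (MI I)" for x
    using that a aQ I p q by (simp add: mp_closed phi_closed)
  show thesis
    by (rule that[OF a aQ c sg_eq[OF _ a]])
qed

lemma sg_lin: "klinear (MI I) (loc p q) (sg I p q)"
proof -
  obtain a k where a: "a \<in> I" "q \<preceq> a" "a \<preceq> pt q p k" "a \<in> Q"
    and cl: "\<And>x. x \<in> vcar (MI I) \<Longrightarrow> mp a (pt q p k) (phi I a x) \<in> Mpt p q k"
    and eq: "\<And>x. x \<in> vcar (MI I) \<Longrightarrow> sg I p q x = cls p q k (mp a (pt q p k) (phi I a x))"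
    using sg_rep by metis
  have lin: "klinear (MI I) (M (pt q p k)) (\<lambda>x. mp a (pt q p k) (phi I a x))"
    using klinear_comp[OF phi_lin mp_lin] I a p q by simp
  interpret MI: kvspace "MI I" using MI_kvs[OF I] by unfold_locales
  show ?thesis
    by (rule klinearI)
      (use cl in \<open>auto simp: eq klinearD(2,3)[OF lin] loc_add[OF p q] loc_scale[OF p q] loc_car[OF p q]\<close>)
qed

text \<open>A fraction given at stage \<open>n\<close> is pushed to a point of \<open>I\<close>
  further out and pulled back to \<open>MI I\<close> there; pushing does not change its
  class.\<close>

lemma sg_surj: "sg I p q ` vcar (MI I) = vcar (loc p q)"
proof (intro equalityI subsetI)
  fix A assume "A \<in> sg I p q ` vcar (MI I)"
  then show "A \<in> vcar (loc p q)" using klinearD(1)[OF sg_lin] by auto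
next
  fix A assume "A \<in> vcar (loc p q)"
  then obtain n m where A: "A = cls p q n m" "m \<in> Mpt p q n" unfolding loc_car[OF p q] by blast
  obtain a k where a: "a \<in> I" "n \<le> k" "pt q p n \<preceq> a" "a \<preceq> pt q p k"
    using cof unfolding cofinal_def by blast
  have aQ: "a \<in> Q" using region_Q I a by blast
  have qa: "q \<preceq> a" using qle_trans[OF le_pt[OF p] a(3)] .
  define x where "x = psi I a (mp (pt q p n) a m)"
  have c: "mp (pt q p n) a m \<in> vcar (M a)" using a aQ p q A by (simp add: mp_closed)
  have x: "x \<in> vcar (MI I)" unfolding x_def using psi_closed[OF I a(1) c] .
  have "sg I p q x = cls p q k (mp a (pt q p k) (mp (pt q p n) a m))"
    using sg_eq[OF x a(1) qa a(4)] phi_psi[OF I a(1) c] by (simp add: x_def)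
  also have "\<dots> = cls p q k (push p q n k m)"
    using a aQ p q A by (simp add: mp_comp)
  also have "\<dots> = A" using cls_push[OF p q A(2) a(2)] A(1) by simp
  finally show "A \<in> sg I p q ` vcar (MI I)" using x by blast
qed

text \<open>Equal classes agree at some stage. Pushed on to a point \<open>b\<close> of
  \<open>I\<close> beyond it, they become \<open>phi I b x\<close> and \<open>phi I b y\<close>, and
  \<open>phi I b\<close> is injective.\<close>

lemma sg_inj: "inj_on (sg I p q) (vcar (MI I))"
proof (rule inj_onI)
  fix x y assume xy: "x \<in> vcar (MI I)" "y \<in> vcar (MI I)" "sg I p q x = sg I p q y"
  obtain a k where a: "a \<in> I" "q \<preceq> a" "a \<preceq> pt q p k" "a \<in> Q"
    and cl: "\<And>x. x \<in> vcar (MI I) \<Longrightarrow> mp a (pt q p k) (phi I a x) \<in> Mpt p q k"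
    and eq: "\<And>x. x \<in> vcar (MI I) \<Longrightarrow> sg I p q x = cls p q k (mp a (pt q p k) (phi I a x))"
    using sg_rep by metis
  have "cls p q k (mp a (pt q p k) (phi I a x)) = cls p q k (mp a (pt q p k) (phi I a y))"
    using xy eq by simp
  then obtain N where N: "k \<le> N" "k \<le> N" and
    far: "\<forall>K\<ge>N. push p q k K (mp a (pt q p k) (phi I a x)) = push p q k K (mp a (pt q p k) (phi I a y))"
    using cls_eq_far[OF p q cl[OF xy(1)]] by blast
  obtain b m where b: "b \<in> I" "N \<le> m" "pt q p N \<preceq> b" "b \<preceq> pt q p m"
    using cof unfolding cofinal_def by blast
  have bQ: "b \<in> Q" using region_Q I b by blast
  have ab: "a \<preceq> b" using qle_trans[OF qle_trans[OF a(3) pt_le[OF p N(1)]] b(3)] .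
  have kb: "pt q p k \<preceq> b" using qle_trans[OF pt_le[OF p N(1)] b(3)] .
  have "phi I b z = mp (pt q p N) b (push p q k N (mp a (pt q p k) (phi I a z)))"
    if z: "z \<in> vcar (MI I)" for z
  proof -
    have "mp (pt q p N) b (push p q k N (mp a (pt q p k) (phi I a z))) = mp a b (phi I a z)"
      using a b bQ p q N kb ab cl[OF z] phi_closed[OF I a(1) z] qle_trans[OF a(3) pt_le[OF p N(1)]]
      by (simp add: mp_comp)
    then show ?thesis using mp_phi[OF I a(1) b(1) ab z] by simp
  qed
  then have "phi I b x = phi I b y" using far xy by simp
  then show "x = y" using psi_phi[OF I b(1)] xy(1,2) by metis
qed

lemma sg_zero: "sg I p q (vzero (MI I)) = vzero (loc p q)"
proof -
  obtain a k where a: "a \<in> I" "q \<preceq> a" "a \<preceq> pt q p k" "a \<in> Q"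
    and eq: "\<And>x. x \<in> vcar (MI I) \<Longrightarrow> sg I p q x = cls p q k (mp a (pt q p k) (phi I a x))"
    using sg_rep by metis
  have kvs: "is_kvs (M (pt q p k))" "is_kvs (M q)" "is_kvs (MI I)"
    using p q M_kvs MI_kvs[OF I] by auto
  have lin: "klinear (MI I) (M (pt q p k)) (\<lambda>x. mp a (pt q p k) (phi I a x))"
    using klinear_comp[OF phi_lin mp_lin] I a p q by simp
  have "sg I p q (vzero (MI I)) = cls p q k (vzero (M (pt q p k)))"
    using klinear_zero[OF kvs(3,1) lin] eq kvspace.zero_closed[OF kvspace.intro[OF kvs(3)]] by simp
  also have "vzero (M (pt q p k)) = push p q 0 k (vzero (M q))"
    using klinear_zero[OF kvs(2,1)] push_lin[OF p q, of 0 k] by simp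
  also have "cls p q k \<dots> = cls p q 0 (vzero (M q))"
    using cls_push[OF p q, of "vzero (M q)" 0 k] kvspace.zero_closed[OF kvspace.intro[OF kvs(2)]] by simp
  finally show ?thesis by (simp add: loc_zero[OF p q])
qed

lemma loc_is_kvs: "is_kvs (loc p q)"
  using is_kvs_surj[OF MI_kvs[OF I] sg_lin sg_surj sg_zero] .

lemma loc_fin_dim: "fin_dim (loc p q)"
proof -
  obtain a where a: "a \<in> I" "a \<in> Q" using region_ne[OF I] region_Q[OF I] by blast
  have "psi I a ` vcar (M a) = vcar (MI I)"
    using psi_closed[OF I a(1)] phi_closed[OF I a(1)] psi_phi[OF I a(1)] by (force simp: image_iff)
  then have "fin_dim (MI I)"
    using fin_dim_surj[OF M_kvs M_fin_dim psi_lin] klinear_zero[OF M_kvs MI_kvs psi_lin] I a by blast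
  then show ?thesis
    using fin_dim_surj[OF MI_kvs[OF I] _ sg_lin sg_surj sg_zero] by blast
qed

end

text \<open>A map from \<open>MI I\<close> to \<open>MI J\<close> can be read off the subdivision
  only at comparable points. They exist: a point of \<open>I\<close> below stage \<open>k\<close> of
  the first chain is below stage \<open>k\<close> of the second, and \<open>J\<close> has points
  beyond that.\<close>

lemma cofinal_le_ex:
  assumes p: "p \<in> Qp" "p' \<in> Qp" "p \<preceq> p'" and q: "q \<in> Q" "q' \<in> Q" "q \<preceq> q'"
    and IJ: "cofinal I p q" "cofinal J p' q'"
  obtains a k b m where "a \<in> I" "q \<preceq> a" "a \<preceq> pt q p k" "b \<in> J" "k \<le> m" "pt q' p' k \<preceq> b" "b \<preceq> pt q' p' m"
    "a \<preceq> b"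
proof -
  obtain a k where a: "a \<in> I" "q \<preceq> a" "a \<preceq> pt q p k"
    using IJ(1) unfolding cofinal_def by (metis pt_0)
  obtain b m where b: "b \<in> J" "k \<le> m" "pt q' p' k \<preceq> b" "b \<preceq> pt q' p' m"
    using IJ(2) unfolding cofinal_def by blast
  have "a \<preceq> b"
    using qle_trans[OF qle_trans[OF a(3) pt_mono[OF q(3) p(3)]] b(3)] .
  then show thesis using that a b by blast
qed

text \<open>In the coordinates \<open>sg\<close> the canonical map becomes the map from
  \<open>MI I\<close> to \<open>MI J\<close> of the subdivision, which does not see \<open>q\<close>
  and \<open>q'\<close>. Constancy exchanges the given \<open>i, j\<close> for points
  \<open>a, b\<close> squeezed between stages of the chains; there both sides reduce to one
  structure map of \<open>M\<close>.\<close>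

lemma loc_canon_sg:
  assumes p: "p \<in> Qp" "p' \<in> Qp" "p \<preceq> p'" and q: "q \<in> Q" "q' \<in> Q" "q \<preceq> q'"
    and IJ: "I \<in> P" "J \<in> P" "cofinal I p q" "cofinal J p' q'"
    and ij: "i \<in> I" "j \<in> J" "i \<preceq> j" and x: "x \<in> vcar (MI I)"
  shows "loc_canon M mp p p' q q' (sg I p q x) = sg J p' q' (psi J j (mp i j (phi I i x)))"
proof -
  obtain a k b m where a: "a \<in> I" "q \<preceq> a" "a \<preceq> pt q p k"
    and b: "b \<in> J" "k \<le> m" "pt q' p' k \<preceq> b" "b \<preceq> pt q' p' m" and ab: "a \<preceq> b"
    using cofinal_le_ex[OF p q IJ(3,4)] by metis
  have Q: "a \<in> Q" "b \<in> Q" using a b region_Q IJ by auto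
  have q'b: "q' \<preceq> b" using qle_trans[OF le_pt[OF p(2)] b(3)] .
  have ak: "a \<preceq> pt q' p' k" using qle_trans[OF a(3) pt_mono[OF q(3) p(3)]] .
  have fx: "phi I a x \<in> vcar (M a)" using phi_closed[OF IJ(1) a(1) x] .
  have y: "mp a b (phi I a x) \<in> vcar (M b)" using mp_closed[OF Q ab fx] .
  have "psi J j (mp i j (phi I i x)) = psi J b (mp a b (phi I a x))"
    using subdiv_const[OF IJ(1,2) ij(1,2) a(1) b(1) ij(3) ab x] .
  then have "sg J p' q' (psi J j (mp i j (phi I i x))) =
      cls p' q' m (mp b (pt q' p' m) (mp a b (phi I a x)))"
    using sg_eq[OF IJ(2) p(2) q(2) IJ(4) psi_closed[OF IJ(2) b(1) y] b(1) q'b b(4)]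
      phi_psi[OF IJ(2) b(1) y] by simp
  also have "mp b (pt q' p' m) (mp a b (phi I a x)) = mp a (pt q' p' m) (phi I a x)"
    using Q p q b(4) ab fx by (intro mp_comp) auto
  also have "\<dots> = push p' q' k m (mp a (pt q' p' k) (phi I a x))"
    using Q p q b(2) ak fx by (intro mp_comp[symmetric]) auto
  also have "cls p' q' m \<dots> = cls p' q' k (mp a (pt q' p' k) (phi I a x))"
    using Q p q b(2) ak fx by (intro cls_push mp_closed) auto
  also have "mp a (pt q' p' k) (phi I a x) = mp (pt q p k) (pt q' p' k) (mp a (pt q p k) (phi I a x))"
    using Q p q a pt_mono[OF q(3) p(3)] fx by (intro mp_comp[symmetric]) auto
  also have "cls p' q' k \<dots> = loc_canon M mp p p' q q' (cls p q k (mp a (pt q p k) (phi I a x)))"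
    using Q p q a fx by (intro loc_canon_cls[symmetric] mp_closed) auto
  also have "cls p q k (mp a (pt q p k) (phi I a x)) = sg I p q x"
    using sg_eq[OF IJ(1) p(1) q(1) IJ(3) x a] by simp
  finally show ?thesis by simp
qed

lemma loc_canon_lin:
  assumes p: "p \<in> Qp" "p' \<in> Qp" "p \<preceq> p'" and q: "q \<in> Q" "q' \<in> Q" "q \<preceq> q'"
    and IJ: "I \<in> P" "J \<in> P" "cofinal I p q" "cofinal J p' q'"
  shows "klinear (loc p q) (loc p' q') (loc_canon M mp p p' q q')"
proof -
  obtain i j where ij: "i \<in> I" "j \<in> J" "i \<preceq> j"
    using cofinal_le_ex[OF p q IJ(3,4)] by metis
  have Q: "i \<in> Q" "j \<in> Q" using ij region_Q IJ by auto
  define g where "g x = sg J p' q' (psi J j (mp i j (phi I i x)))" for x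
  have g: "klinear (MI I) (loc p' q') g"
    unfolding g_def
    by (intro klinear_comp[OF klinear_comp[OF klinear_comp[OF phi_lin mp_lin] psi_lin] sg_lin])
      (use ij IJ Q p q in auto)
  have eq: "loc_canon M mp p p' q q' (sg I p q x) = g x" if "x \<in> vcar (MI I)" for x
    unfolding g_def using loc_canon_sg[OF p q IJ ij that] .
  note lin = sg_lin[OF IJ(1) p(1) q(1) IJ(3)]
  interpret MI: kvspace "MI I" using MI_kvs[OF IJ(1)] by unfold_locales
  show ?thesis
    by (rule klinearI)
      (auto simp: sg_surj[OF IJ(1) p(1) q(1) IJ(3), symmetric] klinearD(2,3)[OF lin, symmetric] eq
        klinearD[OF g])
qed

section \<open>Transport between localizations in different degrees\<close>

definition loc_transport :: "'v set \<Rightarrow> 'v \<Rightarrow> 'v \<Rightarrow> 'v \<Rightarrow> (nat \<times> 'e) set \<Rightarrow> (nat \<times> 'e) set" where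
  "loc_transport I p q q' A = sg I p q' (inv_into (vcar (MI I)) (sg I p q) A)"

lemma loc_transport_sg:
  assumes "I \<in> P" "p \<in> Qp" "q \<in> Q" "cofinal I p q" "x \<in> vcar (MI I)"
  shows "loc_transport I p q q' (sg I p q x) = sg I p q' x"
  using inv_into_f_f[OF sg_inj[OF assms(1-4)] assms(5)] by (simp add: loc_transport_def)

lemma loc_transport_lin:
  assumes "I \<in> P" "p \<in> Qp" "q \<in> Q" "q' \<in> Q" "cofinal I p q" "cofinal I p q'"
  shows "klinear (loc p q) (loc p q') (loc_transport I p q q')"
proof -
  note lin = sg_lin[OF assms(1,2,3,5)] and lin' = sg_lin[OF assms(1,2,4,6)]
  interpret MI: kvspace "MI I" using MI_kvs[OF assms(1)] by unfold_locales
  show ?thesis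
    by (rule klinearI)
      (auto simp: sg_surj[OF assms(1,2,3,5), symmetric] klinearD(2,3)[OF lin, symmetric]
        loc_transport_sg[OF assms(1,2,3,5)] klinearD[OF lin'])
qed

text \<open>By \<open>loc_canon_sg\<close> a single pair \<open>i, j\<close> describes the canonical
  maps at both places, so both sides are the same element of \<open>MI J\<close> read at
  \<open>q2'\<close>.\<close>

lemma loc_transport_canon:
  assumes p: "p \<in> Qp" "p' \<in> Qp" "p \<preceq> p'" and q: "q1 \<in> Q" "q2 \<in> Q" "q1' \<in> Q" "q2' \<in> Q"
    and le: "q1 \<preceq> q1'" "q2 \<preceq> q2'" and IJ: "I \<in> P" "J \<in> P"
    and cof: "cofinal I p q1" "cofinal I p q2" "cofinal J p' q1'" "cofinal J p' q2'"
    and A: "A \<in> vcar (loc p q1)"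
  shows "loc_transport J p' q1' q2' (loc_canon M mp p p' q1 q1' A) =
    loc_canon M mp p p' q2 q2' (loc_transport I p q1 q2 A)"
proof -
  obtain i j where ij: "i \<in> I" "j \<in> J" "i \<preceq> j"
    using cofinal_le_ex[OF p q(1,3) le(1) cof(1,3)] by metis
  have Q: "i \<in> Q" "j \<in> Q" using ij region_Q IJ by auto
  obtain x where x: "x \<in> vcar (MI I)" "A = sg I p q1 x"
    using A sg_surj[OF IJ(1) p(1) q(1) cof(1)] by blast
  have y: "psi J j (mp i j (phi I i x)) \<in> vcar (MI J)"
    using ij IJ Q x(1) by (simp add: psi_closed mp_closed phi_closed)
  show ?thesis
    unfolding x(2) loc_transport_sg[OF IJ(1) p(1) q(1) cof(1) x(1)]
      loc_canon_sg[OF p q(1,3) le(1) IJ cof(1,3) ij x(1)]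
      loc_canon_sg[OF p q(2,4) le(2) IJ cof(2,4) ij x(1)]
      loc_transport_sg[OF IJ(2) p(2) q(3) cof(3) y] ..
qed

end

section \<open>The Cech complex\<close>

lemma cech_pi: "cech M mp qs l q = pi_kvs (csets (length qs) l) (\<lambda>S. loc_kvs M mp (psum qs S) q)"
  by (simp add: cech_def pi_kvs_def)

lemma cech_map_pi:
  "cech_map M mp qs l q q' = pi_map (csets (length qs) l) (\<lambda>S. loc_map M mp (psum qs S) q q')"
  by (simp add: fun_eq_iff cech_map_def pi_map_def)

lemma csets_subset: "S \<in> csets r l \<Longrightarrow> S \<subseteq> {..<r}"
  by (simp add: csets_def)

lemma finite_csets: "finite (csets r l)"
  by (rule finite_subset[of _ "Pow {..<r}"]) (auto simp: csets_def)

lemma csets_remove: "T \<in> csets r (Suc l) \<Longrightarrow> j \<in> T \<Longrightarrow> T - {j} \<in> csets r l"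
  by (auto simp: csets_def)

text \<open>\<open>rg S q\<close> is the region \<open>I\<close> through which \<open>M[m_S^{-1}]_q\<close> is identified with \<open>M_I\<close>.\<close>
locale cech_module = subdivided_module Q Qp M mp X P MI phi psi
  for Q Qp :: "'v::euclidean_space set" and M :: "'v \<Rightarrow> ('k::field, 'e) kvs" and mp X P MI phi psi +
  fixes qs :: "'v list" and R :: "'v set set" and rg :: "nat set \<Rightarrow> 'v \<Rightarrow> 'v set"
  assumes qs: "set qs \<subseteq> Qp"
    and R: "region_partition X Q R"
    and rg: "\<And>S q. S \<subseteq> {..<length qs} \<Longrightarrow> q \<in> Q \<Longrightarrow> rg S q \<in> P"
      "\<And>S q. S \<subseteq> {..<length qs} \<Longrightarrow> q \<in> Q \<Longrightarrow> cofinal (rg S q) (psum qs S) q"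
    and rg_const: "\<And>S B q q'. S \<subseteq> {..<length qs} \<Longrightarrow> B \<in> R \<Longrightarrow> q \<in> B \<Longrightarrow> q' \<in> B \<Longrightarrow> rg S q = rg S q'"
begin

abbreviation "L S q \<equiv> loc_kvs M mp (psum qs S) q"
abbreviation "Ch l q \<equiv> cech M mp qs l q"
abbreviation "chg S T q \<equiv> loc_change M mp (psum qs S) (psum qs T) q"
abbreviation "r \<equiv> length qs"

lemma psum_Qp: "S \<subseteq> {..<r} \<Longrightarrow> psum qs S \<in> Qp"
proof -
  have "(\<Sum>i\<in>S. qs ! i) \<in> Qp" if "finite S" "S \<subseteq> {..<r}" for S
    using that
  proof (induction rule: finite_induct)
    case (insert i S)
    then have "qs ! i \<in> Qp" using qs by (auto simp: subset_eq)
    then show ?case using insert by simp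
  qed simp
  then show "S \<subseteq> {..<r} \<Longrightarrow> psum qs S \<in> Qp"
    using finite_subset[of S "{..<r}"] by (auto simp: psum_def)
qed

lemma psum_mono:
  assumes "S \<subseteq> T" "T \<subseteq> {..<r}"
  shows "psum qs S \<preceq> psum qs T"
proof -
  have "psum qs T = psum qs S + psum qs (T - S)"
    unfolding psum_def using assms finite_subset[of T "{..<r}"] sum.subset_diff[of S T] by (simp add: add.commute)
  then show ?thesis using psum_Qp[of "T - S"] assms by (auto simp: qle_def)
qed

lemma R_Q: "B \<in> R \<Longrightarrow> q \<in> B \<Longrightarrow> q \<in> Q"
  using R unfolding region_partition_def by blast

context
  fixes S assumes S: "S \<subseteq> {..<r}"
begin

lemma L_kvs: "q \<in> Q \<Longrightarrow> is_kvs (L S q)"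
  using loc_is_kvs[OF rg(1) psum_Qp _ rg(2)] S by blast

lemma L_fin_dim: "q \<in> Q \<Longrightarrow> fin_dim (L S q)"
  using loc_fin_dim[OF rg(1) psum_Qp _ rg(2)] S by blast

lemma loc_map_lin: "q \<in> Q \<Longrightarrow> q' \<in> Q \<Longrightarrow> q \<preceq> q' \<Longrightarrow> klinear (L S q) (L S q') (loc_map M mp (psum qs S) q q')"
  unfolding loc_map_canon
  by (intro loc_canon_lin[where I = "rg S q" and J = "rg S q'"] psum_Qp rg S qle_refl)

lemma L_elem: "q \<in> Q \<Longrightarrow> A \<in> vcar (L S q) \<Longrightarrow> \<exists>n x. A = cls (psum qs S) q n x \<and> x \<in> Mpt (psum qs S) q n"
  using loc_car[OF psum_Qp[OF S]] by auto

lemma loc_map_cls: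
  assumes "q \<in> Q" "q' \<in> Q" "q \<preceq> q'" "x \<in> Mpt (psum qs S) q n"
  shows "loc_map M mp (psum qs S) q q' (cls (psum qs S) q n x) =
    cls (psum qs S) q' n (mp (pt q (psum qs S) n) (pt q' (psum qs S) n) x)"
  unfolding loc_map_canon using assms psum_Qp[OF S] by (intro loc_canon_cls) auto

lemma loc_map_id:
  assumes "q \<in> Q" "A \<in> vcar (L S q)"
  shows "loc_map M mp (psum qs S) q q A = A"
proof -
  obtain n x where A: "A = cls (psum qs S) q n x" "x \<in> Mpt (psum qs S) q n"
    using L_elem assms by blast
  then show ?thesis
    using loc_map_cls[OF assms(1,1) _ A(2)] assms psum_Qp[OF S] by (simp add: mp_id)
qed

lemma loc_map_comp:
  assumes q: "q \<in> Q" "q' \<in> Q" "q'' \<in> Q" and le: "q \<preceq> q'" "q' \<preceq> q''" and A: "A \<in> vcar (L S q)"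
  shows "loc_map M mp (psum qs S) q' q'' (loc_map M mp (psum qs S) q q' A) =
    loc_map M mp (psum qs S) q q'' A"
proof -
  note p = psum_Qp[OF S]
  obtain n x where A: "A = cls (psum qs S) q n x" "x \<in> Mpt (psum qs S) q n"
    using L_elem q A by blast
  have m: "pt q (psum qs S) n \<preceq> pt q' (psum qs S) n" "pt q' (psum qs S) n \<preceq> pt q'' (psum qs S) n"
    using le pt_mono by auto
  show ?thesis
    using q p A m qle_trans[OF le] by (simp add: loc_map_cls le mp_closed mp_comp)
qed

end

lemma chg_lin:
  assumes "S \<subseteq> T" "T \<subseteq> {..<r}" "q \<in> Q"
  shows "klinear (L S q) (L T q) (chg S T q)"
proof -
  have S: "S \<subseteq> {..<r}" using assms by auto
  show ?thesis
    unfolding loc_change_canon using assms(3)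
    by (intro loc_canon_lin[where I = "rg S q" and J = "rg T q"] psum_Qp psum_mono rg S assms qle_refl)
qed

lemma chg_loc_map:
  assumes S: "S \<subseteq> T" "T \<subseteq> {..<r}" and q: "q \<in> Q" "q' \<in> Q" "q \<preceq> q'" and A: "A \<in> vcar (L S q)"
  shows "loc_map M mp (psum qs T) q q' (chg S T q A) = chg S T q' (loc_map M mp (psum qs S) q q' A)"
proof -
  have S': "S \<subseteq> {..<r}" using S by auto
  note p = psum_Qp[OF S'] psum_Qp[OF S(2)] psum_mono[OF S]
  obtain n x where A: "A = cls (psum qs S) q n x" "x \<in> Mpt (psum qs S) q n"
    using L_elem[OF S'] q A by blast
  have m: "pt q (psum qs S) n \<preceq> pt q' (psum qs S) n" "pt q (psum qs T) n \<preceq> pt q' (psum qs T) n"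
    "pt a (psum qs S) n \<preceq> pt a (psum qs T) n" for a
    using q p pt_mono by auto
  have c: "loc_change M mp (psum qs S) (psum qs T) a (cls (psum qs S) a n y) =
      cls (psum qs T) a n (mp (pt a (psum qs S) n) (pt a (psum qs T) n) y)"
    if "a \<in> Q" "y \<in> Mpt (psum qs S) a n" for a y
    unfolding loc_change_canon using that p by (intro loc_canon_cls) auto
  show ?thesis
    using p q A m by (simp add: c loc_map_cls S S' mp_closed mp_comp qle_trans[OF m(1,3)] qle_trans[OF m(3,2)])
qed

text \<open>\<open>rg\<close> is evaluated at the source; on a member of \<open>R\<close> it agrees
  with its value at the target.\<close>

definition lt :: "nat set \<Rightarrow> 'v \<Rightarrow> 'v \<Rightarrow> (nat \<times> 'e) set \<Rightarrow> (nat \<times> 'e) set" where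
  "lt S q q' = loc_transport (rg S q) (psum qs S) q q'"

lemma lt_lin:
  assumes "S \<subseteq> {..<r}" "B \<in> R" "q \<in> B" "q' \<in> B"
  shows "klinear (L S q) (L S q') (lt S q q')"
proof -
  have Q: "q \<in> Q" "q' \<in> Q" using R_Q assms by auto
  have "cofinal (rg S q) (psum qs S) q'"
    using rg(2)[OF assms(1) Q(2)] rg_const[OF assms] by simp
  then show ?thesis
    unfolding lt_def by (intro loc_transport_lin psum_Qp rg assms Q)
qed

lemma lt_comp:
  assumes S: "S \<subseteq> {..<r}" "B \<in> R" "q \<in> B" "q' \<in> B" "q'' \<in> B" and A: "A \<in> vcar (L S q)"
  shows "lt S q' q'' (lt S q q' A) = lt S q q'' A"
proof -
  note Q = R_Q[OF S(2)]
  have eq: "rg S q' = rg S q" "rg S q'' = rg S q" using rg_const[OF S(1,2)] S by blast+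
  have cof: "cofinal (rg S q) (psum qs S) q" "cofinal (rg S q) (psum qs S) q'"
    using rg(2)[of S] S Q eq by metis+
  have I: "rg S q \<in> P" using rg S Q by auto
  obtain x where x: "x \<in> vcar (MI (rg S q))" "A = sg (rg S q) (psum qs S) q x"
    using A sg_surj[OF I psum_Qp _ cof(1)] S Q by blast
  show ?thesis
    using x I S Q cof by (simp add: lt_def eq loc_transport_sg psum_Qp)
qed

lemma lt_id:
  assumes "S \<subseteq> {..<r}" "B \<in> R" "q \<in> B" "A \<in> vcar (L S q)"
  shows "lt S q q A = A"
proof -
  have Q: "q \<in> Q" using R_Q assms by blast
  note c = rg(1)[OF assms(1) Q] psum_Qp[OF assms(1)] Q rg(2)[OF assms(1) Q]
  obtain x where x: "x \<in> vcar (MI (rg S q))" "A = sg (rg S q) (psum qs S) q x"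
    using assms(4) sg_surj[OF c] by blast
  then show ?thesis
    using loc_transport_sg[OF c] by (simp add: lt_def)
qed

text \<open>One square for two uses: \<open>S = T\<close> gives compatibility with the structure
  maps, while \<open>i = j\<close> and \<open>i' = j'\<close> give compatibility with the changes of
  localization inside the differential.\<close>

lemma lt_canon:
  assumes S: "S \<subseteq> T" "T \<subseteq> {..<r}" and B: "B \<in> R" "B' \<in> R" "i \<in> B" "i' \<in> B" "j \<in> B'" "j' \<in> B'"
    and le: "i \<preceq> j" "i' \<preceq> j'" and A: "A \<in> vcar (L S i)"
  shows "lt T j j' (loc_canon M mp (psum qs S) (psum qs T) i j A) =
    loc_canon M mp (psum qs S) (psum qs T) i' j' (lt S i i' A)"
proof -
  have S': "S \<subseteq> {..<r}" using S by auto
  have Q: "i \<in> Q" "i' \<in> Q" "j \<in> Q" "j' \<in> Q" using B R_Q by auto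
  have eq: "rg S i' = rg S i" "rg T j' = rg T j" using rg_const[OF S' B(1)] rg_const[OF S(2) B(2)] B by blast+
  have cof: "cofinal (rg S i) (psum qs S) i'" "cofinal (rg T j) (psum qs T) j'"
    using rg(2)[of S i'] rg(2)[of T j'] S S' Q eq by auto
  show ?thesis
    unfolding lt_def
    by (intro loc_transport_canon psum_Qp psum_mono S S' Q le rg cof A)
qed

section \<open>Terms, differentials, cycles and boundaries of the complex\<close>

lemma Ch_kvs: "q \<in> Q \<Longrightarrow> is_kvs (Ch l q)"
  unfolding cech_pi by (intro pi_kvs_is_kvs L_kvs csets_subset)

lemma Ch_fin_dim: "q \<in> Q \<Longrightarrow> fin_dim (Ch l q)"
  unfolding cech_pi by (intro pi_kvs_fin_dim finite_csets L_kvs L_fin_dim csets_subset)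

lemma Ch_elem: "f \<in> vcar (Ch l q) \<Longrightarrow> S \<in> csets r l \<Longrightarrow> f S \<in> vcar (L S q)"
  by (simp add: cech_def)

lemma cech_d_lin:
  assumes "q \<in> Q"
  shows "klinear (Ch l q) (Ch (Suc l) q) (cech_d M mp qs l q)"
  unfolding cech_pi cech_d_def
proof (intro klinear_into_pi klinear_foldr L_kvs csets_subset assms, assumption)
  fix T j assume T: "T \<in> csets r (Suc l)" and "j \<in> set (sorted_list_of_set T)"
  moreover have "finite T" using finite_subset[OF csets_subset[OF T]] by simp
  ultimately have j: "j \<in> T" by simp
  note T' = csets_subset[OF T]
  show "klinear (pi_kvs (csets r l) (\<lambda>S. L S q)) (L T q)
      (\<lambda>f. vscale (L T q) ((- 1) ^ card {i \<in> T. i < j}) (chg (T - {j}) T q (f (T - {j}))))"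
    by (intro klinear_scale L_kvs assms T' klinear_comp[OF pi_kvs_proj[OF csets_remove[OF T j]]]
        chg_lin) auto
qed

text \<open>A family of maps of localizations compatible with the changes of localization is a
  chain map; this covers the structure maps as well as the transport maps.\<close>
context
  fixes q q' g
  assumes q: "q \<in> Q" "q' \<in> Q"
    and g_lin: "\<And>S. S \<subseteq> {..<r} \<Longrightarrow> klinear (L S q) (L S q') (g S)"
    and g_chg: "\<And>S T A. S \<subseteq> T \<Longrightarrow> T \<subseteq> {..<r} \<Longrightarrow> A \<in> vcar (L S q) \<Longrightarrow>
      g T (chg S T q A) = chg S T q' (g S A)"
begin

lemma chain_lin: "klinear (Ch l q) (Ch l q') (pi_map (csets r l) g)"
  unfolding cech_pi by (intro pi_map_klinear g_lin csets_subset)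

text \<open>The signs depend on \<open>T\<close> and \<open>j\<close> only, so linearity moves
  \<open>g T\<close> through the signed sum and \<open>g_chg\<close> moves it past each change of
  localization.\<close>

lemma chain_d:
  assumes f: "f \<in> vcar (Ch l q)"
  shows "cech_d M mp qs l q' (pi_map (csets r l) g f) = pi_map (csets r (Suc l)) g (cech_d M mp qs l q f)"
proof
  fix T
  show "cech_d M mp qs l q' (pi_map (csets r l) g f) T =
    pi_map (csets r (Suc l)) g (cech_d M mp qs l q f) T"
  proof (cases "T \<in> csets r (Suc l)")
    case False
    then show ?thesis by (simp add: cech_d_def pi_map_def)
  next
    case True
    note T = csets_subset[OF True]
    have fin: "finite T" using finite_subset[OF T] by simp
    note glin = klinearD[OF g_lin[OF T]]
    let ?c = "\<lambda>j. (- 1) ^ card {i \<in> T. i < j} :: 'k"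
    let ?F = "\<lambda>j. vscale (L T q) (?c j) (chg (T - {j}) T q (f (T - {j})))"
    have mem: "f (T - {j}) \<in> vcar (L (T - {j}) q)" if "j \<in> T" for j
      using Ch_elem[OF f csets_remove[OF True that]] .
    have cm: "chg (T - {j}) T q (f (T - {j})) \<in> vcar (L T q)" if "j \<in> T" for j
      using klinearD(1)[OF chg_lin mem[OF that]] T q by blast
    have Fm: "?F j \<in> vcar (L T q)" if "j \<in> T" for j
      using kvspace.scale_closed[OF kvspace.intro[OF L_kvs[OF T q(1)]] cm[OF that]] .
    have "pi_map (csets r (Suc l)) g (cech_d M mp qs l q f) T =
        g T (foldr (vadd (L T q)) (map ?F (sorted_list_of_set T)) (vzero (L T q)))"
      using True by (simp add: pi_map_def cech_d_def)
    also have "\<dots> = foldr (vadd (L T q')) (map (\<lambda>j. g T (?F j)) (sorted_list_of_set T)) (vzero (L T q'))"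
      using fin Fm by (intro klinear_apply_foldr L_kvs g_lin q T) auto
    also have "map (\<lambda>j. g T (?F j)) (sorted_list_of_set T) =
        map (\<lambda>j. vscale (L T q') (?c j)
          (chg (T - {j}) T q' (pi_map (csets r l) g f (T - {j})))) (sorted_list_of_set T)"
    proof (rule map_cong[OF refl])
      fix j assume "j \<in> set (sorted_list_of_set T)"
      then have j: "j \<in> T" using fin by simp
      show "g T (?F j) = vscale (L T q') (?c j) (chg (T - {j}) T q' (pi_map (csets r l) g f (T - {j})))"
        using glin(3)[OF cm[OF j]] g_chg[OF _ T mem[OF j]] csets_remove[OF True j]
        by (simp add: pi_map_def)
    qed
    finally show ?thesis using True by (simp add: cech_d_def)
  qed
qed

lemma chain_zero: "pi_map (csets r l) g (vzero (Ch l q)) = vzero (Ch l q')"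
  using klinear_zero[OF Ch_kvs Ch_kvs chain_lin] q by blast

lemma chain_cycles: "pi_map (csets r l) g ` cech_cycles M mp qs l q \<subseteq> cech_cycles M mp qs l q'"
  using klinearD(1)[OF chain_lin] chain_d chain_zero[of "Suc l"] by (auto simp: cech_cycles_def)

lemma chain_bounds: "pi_map (csets r l) g ` cech_bounds M mp qs l q \<subseteq> cech_bounds M mp qs l q'"
proof (cases l)
  case 0
  then show ?thesis using chain_zero by (simp add: cech_bounds_def)
next
  case (Suc l')
  then show ?thesis
    using klinearD(1)[OF chain_lin, of _ l'] chain_d[of _ l', symmetric] by (auto simp: cech_bounds_def)
qed

end

lemma cycles_ksub: "q \<in> Q \<Longrightarrow> ksub (Ch l q) (cech_cycles M mp qs l q)"
  unfolding cech_cycles_def by (intro ksub_kernel Ch_kvs cech_d_lin)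

lemma bounds_ksub: "q \<in> Q \<Longrightarrow> ksub (Ch l q) (cech_bounds M mp qs l q)"
  by (cases l) (auto simp: cech_bounds_def intro: ksub_zero ksub_image Ch_kvs cech_d_lin)

lemmas map_chain = chain_lin chain_d chain_cycles chain_bounds

lemma cech_map_chain:
  assumes q: "q \<in> Q" "q' \<in> Q" "q \<preceq> q'"
  shows "klinear (Ch l q) (Ch l q') (cech_map M mp qs l q q')"
    and "f \<in> vcar (Ch l q) \<Longrightarrow> cech_d M mp qs l q' (cech_map M mp qs l q q' f) =
      cech_map M mp qs (Suc l) q q' (cech_d M mp qs l q f)"
    and "cech_map M mp qs l q q' ` cech_cycles M mp qs l q \<subseteq> cech_cycles M mp qs l q'"
    and "cech_map M mp qs l q q' ` cech_bounds M mp qs l q \<subseteq> cech_bounds M mp qs l q'"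
  unfolding cech_map_pi by (intro map_chain q loc_map_lin chg_loc_map; assumption)+

lemma cech_qmod: "is_qmod Q Qp (cech M mp qs l) (cech_map M mp qs l)"
proof (rule is_qmodI)
  show "cech_map M mp qs l q q f = f" if "q \<in> Q" "f \<in> vcar (Ch l q)" for q f
    using that klinearD(1)[OF cech_map_chain(1)[of q q]]
    by (intro pi_kvs_eqI[of _ "csets r l" "\<lambda>S. L S q"])
      (auto simp: cech_pi[symmetric] cech_map_def loc_map_id csets_subset Ch_elem)
  show "cech_map M mp qs l q' q'' (cech_map M mp qs l q q' f) = cech_map M mp qs l q q'' f"
    if "q \<in> Q" "q' \<in> Q" "q'' \<in> Q" "q \<preceq> q'" "q' \<preceq> q''" "f \<in> vcar (Ch l q)" for q q' q'' f
    using that by (auto simp: fun_eq_iff cech_map_def loc_map_comp csets_subset Ch_elem)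
qed (intro Ch_kvs cech_map_chain; assumption)+

abbreviation "ct l q q' \<equiv> pi_map (csets r l) (\<lambda>S. lt S q q')"

context
  fixes B i j assumes B: "B \<in> R" "i \<in> B" "j \<in> B"
begin

lemma lt_chg:
  assumes "S \<subseteq> T" "T \<subseteq> {..<r}" "A \<in> vcar (L S i)"
  shows "lt T i j (chg S T i A) = chg S T j (lt S i j A)"
  unfolding loc_change_canon using lt_canon[OF assms(1,2) B(1,1) B(2,3,2,3) _ _ assms(3)] by simp

lemma ct_chain:
  shows "klinear (Ch l i) (Ch l j) (ct l i j)"
    and "f \<in> vcar (Ch l i) \<Longrightarrow> cech_d M mp qs l j (ct l i j f) = ct (Suc l) i j (cech_d M mp qs l i f)"
    and "ct l i j ` cech_cycles M mp qs l i \<subseteq> cech_cycles M mp qs l j"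
    and "ct l i j ` cech_bounds M mp qs l i \<subseteq> cech_bounds M mp qs l j"
  by (intro map_chain R_Q[OF B(1)] B(2,3) lt_lin[OF _ B] lt_chg; assumption)+

end

lemma cech_transport: "transport R Qp (cech M mp qs l) (cech_map M mp qs l) (ct l)"
proof (rule transportI)
  show "klinear (Ch l i) (Ch l j) (ct l i j)" if "B \<in> R" "i \<in> B" "j \<in> B" for B i j
    using ct_chain(1) that by blast
  show "ct l i i f = f" if "B \<in> R" "i \<in> B" "f \<in> vcar (Ch l i)" for B i f
    using that klinearD(1)[OF ct_chain(1)[of B i i]]
    by (intro pi_kvs_eqI[of _ "csets r l" "\<lambda>S. L S i"])
      (auto simp: cech_pi[symmetric] pi_map_def lt_id csets_subset Ch_elem)
  show "ct l j k (ct l i j f) = ct l i k f"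
    if "B \<in> R" "i \<in> B" "j \<in> B" "k \<in> B" "f \<in> vcar (Ch l i)" for B i j k f
    using that by (auto simp: fun_eq_iff pi_map_def lt_comp csets_subset Ch_elem)
  show "ct l j j' (cech_map M mp qs l i j f) = cech_map M mp qs l i' j' (ct l i i' f)"
    if a: "B \<in> R" "B' \<in> R" "i \<in> B" "j \<in> B'" "i' \<in> B" "j' \<in> B'" "i \<preceq> j" "i' \<preceq> j'"
      "f \<in> vcar (Ch l i)" for B B' i j i' j' f
  proof
    fix S
    show "ct l j j' (cech_map M mp qs l i j f) S = cech_map M mp qs l i' j' (ct l i i' f) S"
      using lt_canon[OF subset_refl _ a(1,2,3,5,4,6,7,8) Ch_elem[OF a(9)], of S]
      by (simp add: pi_map_def cech_map_def loc_map_canon csets_subset)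
  qed
qed

theorem cech_class_X_module: "class_X_module X Q Qp (cech M mp qs l) (cech_map M mp qs l)"
  using transport_class_X_module[OF R cech_qmod cech_transport Ch_fin_dim] .

text \<open>The terms of all degrees are transported along the same \<open>R\<close>, which provides
  the common subdivision that a morphism requires.\<close>

theorem cech_d_class_X_hom:
  "class_X_hom X Q Qp (cech M mp qs l) (cech_map M mp qs l)
     (cech M mp qs (Suc l)) (cech_map M mp qs (Suc l)) (cech_d M mp qs l)"
proof (rule transport_class_X_hom[OF R _ cech_transport cech_transport])
  show "is_qhom Q Qp (cech M mp qs l) (cech_map M mp qs l)
     (cech M mp qs (Suc l)) (cech_map M mp qs (Suc l)) (cech_d M mp qs l)"
    unfolding is_qhom_def
    by (intro conjI ballI impI cech_qmod cech_d_lin cech_map_chain(2); assumption)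
  show "cech_d M mp qs l j (ct l i j f) = ct (Suc l) i j (cech_d M mp qs l i f)"
    if "B \<in> R" "i \<in> B" "j \<in> B" "f \<in> vcar (Ch l i)" for B i j f
    using ct_chain(2)[OF that] .
qed

theorem loccoh_class_X_module: "class_X_module X Q Qp (loccoh M mp qs l) (loccoh_map M mp qs l)"
proof -
  let ?t = "\<lambda>q q'. quot_map (Ch l q') (cech_bounds M mp qs l q') (ct l q q')"
  have eq: "loccoh M mp qs l = (\<lambda>q. quot_kvs (Ch l q) (cech_cycles M mp qs l q) (cech_bounds M mp qs l q))"
    "loccoh_map M mp qs l = (\<lambda>q q'. quot_map (Ch l q') (cech_bounds M mp qs l q') (cech_map M mp qs l q q'))"
    by (simp_all add: fun_eq_iff loccoh_def loccoh_map_def quot_map_def)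
  have "is_qmod Q Qp (loccoh M mp qs l) (loccoh_map M mp qs l)"
    unfolding eq
    by (rule subquot_is_qmod[OF cech_qmod cycles_ksub bounds_ksub cech_map_chain(3,4) qle_refl qle_trans])
  moreover have "transport R Qp (loccoh M mp qs l) (loccoh_map M mp qs l) ?t"
    unfolding eq
    by (rule subquot_transport[OF cech_qmod cech_transport _ cycles_ksub bounds_ksub
          cech_map_chain(4) ct_chain(3,4)]) (use R in \<open>simp add: region_partition_def\<close>)
  moreover have "fin_dim (loccoh M mp qs l q)" if "q \<in> Q" for q
    unfolding loccoh_def
    using kvspace.quot_is_kvs(2)[OF kvspace.intro[OF Ch_kvs]] that cycles_ksub bounds_ksub Ch_fin_dim
    by blast
  ultimately show ?thesis
    using transport_class_X_module[OF R] by blast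
qed

end

section \<open>Regions of class X\<close>

definition ncone :: "'v::real_vector list \<Rightarrow> nat set \<Rightarrow> 'v set" where
  "ncone qs S = {\<Sum>i\<in>S. real (f i) *\<^sub>R (qs ! i) | f. True}"

lemma ncone_empty: "ncone qs {} = {0}"
  by (simp add: ncone_def)

lemma ncone_insert:
  assumes "finite S" "j \<notin> S"
  shows "ncone qs (insert j S) = msum {real n *\<^sub>R (qs ! j) | n. True} (ncone qs S)"
proof (intro equalityI subsetI)
  fix x assume "x \<in> ncone qs (insert j S)"
  then obtain f where "x = real (f j) *\<^sub>R (qs ! j) + (\<Sum>i\<in>S. real (f i) *\<^sub>R (qs ! i))"
    using assms by (auto simp: ncone_def)
  then show "x \<in> msum {real n *\<^sub>R (qs ! j) | n. True} (ncone qs S)"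
    unfolding msum_def ncone_def by blast
next
  fix x assume "x \<in> msum {real n *\<^sub>R (qs ! j) | n. True} (ncone qs S)"
  then obtain n f where x: "x = real n *\<^sub>R (qs ! j) + (\<Sum>i\<in>S. real (f i) *\<^sub>R (qs ! i))"
    unfolding msum_def ncone_def by blast
  have "(\<Sum>i\<in>S. real (f i) *\<^sub>R (qs ! i)) = (\<Sum>i\<in>S. real ((f(j := n)) i) *\<^sub>R (qs ! i))"
    using assms by (intro sum.cong) auto
  then have "x = (\<Sum>i\<in>insert j S. real ((f(j := n)) i) *\<^sub>R (qs ! i))"
    using assms x by simp
  then show "x \<in> ncone qs (insert j S)" unfolding ncone_def by blast
qed

lemma ncone_0: "0 \<in> ncone qs S"
  unfolding ncone_def by (intro CollectI exI[of _ "\<lambda>_. 0"]) simp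

lemma ncone_add:
  assumes "a \<in> ncone qs S" "b \<in> ncone qs S"
  shows "a + b \<in> ncone qs S"
proof -
  obtain f g where "a = (\<Sum>i\<in>S. real (f i) *\<^sub>R (qs ! i))" "b = (\<Sum>i\<in>S. real (g i) *\<^sub>R (qs ! i))"
    using assms unfolding ncone_def by blast
  then have "a + b = (\<Sum>i\<in>S. real (f i + g i) *\<^sub>R (qs ! i))"
    by (simp add: sum.distrib scaleR_add_left)
  then show ?thesis unfolding ncone_def by (intro CollectI exI[of _ "\<lambda>i. f i + g i"]) simp
qed

lemma msum_assoc: "msum (msum A B) C = msum A (msum B C)"
  unfolding msum_def by (auto, metis add.assoc, metis add.assoc)

text \<open>Summability is available for one generator at a time; the cone is the Minkowski sum of
  the semigroups of its generators, which can be added in turn.\<close>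

lemma ncone_msum_class:
  assumes "finite S" "\<And>i. i \<in> S \<Longrightarrow> minkowski_summable X {real n *\<^sub>R (qs ! i) | n. True}" "A \<in> X"
  shows "msum (ncone qs S) A \<in> X"
  using assms(1,2)
proof (induction S rule: finite_induct)
  case empty
  then show ?case using assms(3) by (simp add: ncone_empty msum_def)
next
  case (insert j S)
  then show ?case
    by (simp add: ncone_insert msum_assoc minkowski_summable_def)
qed

definition often :: "'v::real_vector set \<Rightarrow> 'v list \<Rightarrow> nat set \<Rightarrow> 'v set \<Rightarrow> 'v set" where
  "often Q qs S I = {q \<in> Q. \<forall>a\<in>ncone qs S. \<exists>b\<in>ncone qs S. q + a + b \<in> I}"

text \<open>The set is \<open>A - C\<close> for the cone \<open>C\<close>. Rewriting it as
  \<open>-(C + (-A))\<close> expresses the difference by negation and a sum with \<open>C\<close>,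
  operations under which \<open>X\<close> is closed.\<close>

lemma minus_ncone_class:
  assumes "class_X_family X Q Qp" "finite S"
    "\<And>i. i \<in> S \<Longrightarrow> minkowski_summable X {real n *\<^sub>R (qs ! i) | n. True}" "A \<in> X"
  shows "{q. \<exists>c\<in>ncone qs S. q + c \<in> A} \<in> X"
proof -
  have neg: "uminus ` B \<in> X" if "B \<in> X" for B
    using assms(1) that unfolding class_X_family_def by blast
  have "{q. \<exists>c\<in>ncone qs S. q + c \<in> A} = uminus ` msum (ncone qs S) (uminus ` A)"
  proof (intro equalityI subsetI)
    fix q assume "q \<in> {q. \<exists>c\<in>ncone qs S. q + c \<in> A}"
    then obtain c where c: "c \<in> ncone qs S" "q + c \<in> A" by blast
    have "- q = c + - (q + c)" "- (q + c) \<in> uminus ` A" using imageI[OF c(2), of uminus] by simp_all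
    then have "- q \<in> msum (ncone qs S) (uminus ` A)" unfolding msum_def using c by blast
    then show "q \<in> uminus ` msum (ncone qs S) (uminus ` A)" by force
  next
    fix q assume "q \<in> uminus ` msum (ncone qs S) (uminus ` A)"
    then obtain c a where "c \<in> ncone qs S" "a \<in> A" "q = - (c + - a)" unfolding msum_def by blast
    then show "q \<in> {q. \<exists>c\<in>ncone qs S. q + c \<in> A}" by (auto intro!: bexI[of _ c])
  qed
  then show ?thesis using neg ncone_msum_class[OF assms(2,3)] assms(4) by simp
qed

lemma often_class:
  assumes X: "class_X_family X Q Qp" and S: "finite S"
    and ms: "\<And>i. i \<in> S \<Longrightarrow> minkowski_summable X {real n *\<^sub>R (qs ! i) | n. True}" and I: "I \<in> X"
    and Q: "\<And>q c. q \<in> Q \<Longrightarrow> c \<in> ncone qs S \<Longrightarrow> q + c \<in> Q"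
  shows "often Q qs S I \<in> X"
proof -
  let ?U = "\<lambda>A. {q. \<exists>c\<in>ncone qs S. q + c \<in> A}"
  have compl: "Q - A \<in> X" if "A \<in> X" for A
    using X that unfolding class_X_family_def by blast
  \<comment> \<open>A point is excluded when some translate never returns to \<open>I\<close>;
    closure of \<open>Q\<close> under the cone places that translate in
    \<open>Q - ?U I\<close>.\<close>
  have eq: "often Q qs S I = Q - ?U (Q - ?U I)"
    unfolding often_def using Q by auto
  show ?thesis unfolding eq by (intro compl minus_ncone_class[OF X S ms] I)
qed

text \<open>An atom is given by the pattern \<open>G\<close> of members of \<open>F\<close> that
  contain its points, and is a finite intersection of members of \<open>F\<close> and complements.
  Complements and unions yield the intersections.\<close>

lemma atoms_partition:
  assumes X: "class_X_family X Q Qp" and Q: "Q \<in> X" and F: "finite F" "F \<subseteq> X"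
  shows "\<exists>R. region_partition X Q R \<and> (\<forall>B\<in>R. \<forall>q\<in>B. \<forall>q'\<in>B. \<forall>D\<in>F. q \<in> D \<longleftrightarrow> q' \<in> D)"
proof -
  have compl: "Q - A \<in> X" and un: "A \<union> B \<in> X" and sub: "A \<subseteq> Q" if "A \<in> X" "B \<in> X" for A B
    using X that unfolding class_X_family_def by blast+
  have int: "A \<inter> B \<in> X" if AB: "A \<in> X" "B \<in> X" for A B
  proof -
    have "A \<inter> B = Q - ((Q - A) \<union> (Q - B))" using sub[OF AB] by blast
    then show ?thesis using compl un AB by simp
  qed
  define atom where "atom G = {q \<in> Q. \<forall>D\<in>F. q \<in> D \<longleftrightarrow> D \<in> G}" for G
  have atom: "atom G \<in> X" for G
    unfolding atom_def using F
  proof (induction F rule: finite_induct)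
    case empty
    then show ?case using Q by simp
  next
    case (insert D F)
    have "{q \<in> Q. \<forall>D'\<in>insert D F. q \<in> D' \<longleftrightarrow> D' \<in> G} =
        {q \<in> Q. \<forall>D\<in>F. q \<in> D \<longleftrightarrow> D \<in> G} \<inter> (if D \<in> G then D else Q - D)"
      by auto
    then show ?case using insert compl int by simp
  qed
  \<comment> \<open>Patterns that no point realizes are dropped, as regions have to be
    nonempty.\<close>
  define R where "R = atom ` Pow F - {{}}"
  have "q \<in> \<Union>R" if "q \<in> Q" for q
  proof -
    have q: "q \<in> atom {D \<in> F. q \<in> D}" using that by (simp add: atom_def)
    then have "atom {D \<in> F. q \<in> D} \<in> R" unfolding R_def by (intro DiffI imageI) auto
    then show ?thesis using q by (rule UnionI)
  qed
  moreover have "G = G'" if "q \<in> atom G" "q \<in> atom G'" "G \<subseteq> F" "G' \<subseteq> F" for q G G'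
  proof -
    have "G = {D \<in> F. q \<in> D}" "G' = {D \<in> F. q \<in> D}" using that unfolding atom_def by blast+
    then show ?thesis by simp
  qed
  then have "B \<inter> B' = {}" if "B \<in> R" "B' \<in> R" "B \<noteq> B'" for B B'
    using that unfolding R_def by blast
  moreover have "finite R" "R \<subseteq> X" "\<Union>R \<subseteq> Q"
    using F atom by (auto simp: R_def atom_def)
  ultimately have "region_partition X Q R"
    unfolding region_partition_def by (auto simp: R_def)
  moreover have "\<forall>B\<in>R. \<forall>q\<in>B. \<forall>q'\<in>B. \<forall>D\<in>F. q \<in> D \<longleftrightarrow> q' \<in> D"
    by (auto simp: R_def atom_def)
  ultimately show ?thesis by blast
qed

section \<open>Cones compared with multiples of \<open>psum qs S\<close>\<close>

context po_module
begin

lemma ncone_Qp: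
  assumes "set qs \<subseteq> Qp" "S \<subseteq> {..<length qs}"
  shows "(\<Sum>i\<in>S. real (f i) *\<^sub>R (qs ! i)) \<in> Qp"
proof -
  have "finite S" using finite_subset[OF assms(2)] by simp
  then show ?thesis using assms
  proof (induction S rule: finite_induct)
    case (insert i S)
    then have "qs ! i \<in> Qp" by (auto simp: subset_eq)
    then show ?case using insert by simp
  qed simp
qed

lemma ncone_bounded:
  assumes "set qs \<subseteq> Qp" "S \<subseteq> {..<length qs}" "c \<in> ncone qs S"
  shows "c \<in> Qp" "\<exists>k. c \<preceq> real k *\<^sub>R psum qs S"
proof -
  obtain f where f: "c = (\<Sum>i\<in>S. real (f i) *\<^sub>R (qs ! i))"
    using assms(3) unfolding ncone_def by blast
  show "c \<in> Qp" unfolding f by (rule ncone_Qp[OF assms(1,2)])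
  have fin: "finite S" using finite_subset[OF assms(2)] by simp
  \<comment> \<open>The multiplier \<open>sum f S\<close> dominates every coefficient
    \<open>f i\<close>, so the natural subtraction is exact and the difference is again a
    combination with natural coefficients.\<close>
  have "real (sum f S) *\<^sub>R psum qs S - c = (\<Sum>i\<in>S. real (sum f S - f i) *\<^sub>R (qs ! i))"
    unfolding f psum_def scaleR_sum_right sum_subtractf[symmetric]
    using member_le_sum[of _ S f] fin
    by (intro sum.cong) (simp_all add: of_nat_diff scaleR_diff_left)
  also have "\<dots> \<in> Qp" by (rule ncone_Qp[OF assms(1,2)])
  finally show "\<exists>k. c \<preceq> real k *\<^sub>R psum qs S" unfolding qle_def by blast
qed

end

context subdivided_module
begin

text \<open>Multiples of \<open>psum qs S\<close> belong to the cone, so there is a return to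
  \<open>I\<close> beyond each stage \<open>n\<close>; cone elements lie below such multiples, which
  bounds the return by a later stage.\<close>

lemma often_cofinal:
  assumes qs: "set qs \<subseteq> Qp" and S: "S \<subseteq> {..<length qs}" and q: "q \<in> often Q qs S I"
  shows "cofinal I (psum qs S) q"
  unfolding cofinal_def
proof
  fix n
  let ?p = "psum qs S"
  have "real n *\<^sub>R ?p \<in> ncone qs S"
    unfolding ncone_def psum_def scaleR_sum_right by (intro CollectI exI[of _ "\<lambda>_. n"]) simp
  then obtain b where b: "b \<in> ncone qs S" "q + real n *\<^sub>R ?p + b \<in> I"
    using q unfolding often_def by blast
  obtain k where k: "b \<preceq> real k *\<^sub>R ?p" using ncone_bounded(2)[OF qs S b(1)] by blast
  have "pt q ?p n \<preceq> q + real n *\<^sub>R ?p + b"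
    using ncone_bounded(1)[OF qs S b(1)] by (simp add: qle_def pt_def)
  moreover have "q + real n *\<^sub>R ?p + b \<preceq> pt q ?p (n + k)"
    using k by (simp add: qle_def pt_def scaleR_add_left)
  ultimately show "\<exists>a\<in>I. \<exists>k\<ge>n. pt q ?p n \<preceq> a \<and> a \<preceq> pt q ?p k"
    using b(2) le_add1 by blast
qed

text \<open>Pigeonhole: if no region were hit cofinally, then translating far enough would avoid
  all of the finitely many regions.\<close>
lemma often_ex:
  assumes qs: "set qs \<subseteq> Qp" and S: "S \<subseteq> {..<length qs}" and q: "q \<in> Q"
  shows "\<exists>I\<in>P. q \<in> often Q qs S I"
proof (rule ccontr)
  assume neg: "\<not> (\<exists>I\<in>P. q \<in> often Q qs S I)"
  have "\<exists>a\<in>ncone qs S. \<forall>I\<in>P'. \<forall>b\<in>ncone qs S. q + a + b \<notin> I" if "finite P'" "P' \<subseteq> P" for P'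
    using that
  proof (induction rule: finite_induct)
    case empty
    then show ?case using ncone_0 by blast
  next
    case (insert I P')
    then obtain a where a: "a \<in> ncone qs S" "\<forall>I\<in>P'. \<forall>b\<in>ncone qs S. q + a + b \<notin> I" by blast
    obtain c where c: "c \<in> ncone qs S" "\<forall>b\<in>ncone qs S. q + c + b \<notin> I"
    proof -
      have "q \<notin> often Q qs S I" using neg insert.prems by simp
      then show thesis using q that by (auto simp: often_def)
    qed
    \<comment> \<open>The earlier regions are avoided by reading the translation as
      \<open>a + (c + b)\<close>, the new one by reading it as \<open>c + (a + b)\<close>.\<close>
    have "\<forall>b\<in>ncone qs S. q + (a + c) + b \<notin> J" if "J \<in> insert I P'" for J
    proof
      fix b assume b: "b \<in> ncone qs S"
      show "q + (a + c) + b \<notin> J"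
        using a(2)[rule_format, OF _ ncone_add[OF c(1) b], of J]
          c(2)[rule_format, OF ncone_add[OF a(1) b]] that by (auto simp: algebra_simps)
    qed
    then show ?case using ncone_add[OF a(1) c(1)] by blast
  qed
  then obtain a where a: "a \<in> ncone qs S" "\<forall>I\<in>P. \<forall>b\<in>ncone qs S. q + a + b \<notin> I"
    using regions(1) by blast
  \<comment> \<open>As \<open>0\<close> is in the cone, \<open>q + a\<close> itself would avoid all
    regions, yet they cover \<open>Q\<close>.\<close>
  have "q + a \<in> Q" using q ncone_bounded(1)[OF qs S a(1)] by (simp add: Qp_Q)
  then obtain I where "I \<in> P" "q + a \<in> I" using regions(3) by blast
  then show False using a(2) ncone_0[of qs S] by force
qed

end

theorem theorem6p2:
  fixes X :: "'v::euclidean_space set set"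
    and Q Qp :: "'v set"
    and qs :: "'v list"
    and M :: "'v \<Rightarrow> ('k::field, 'e) kvs"
    and mp :: "'v \<Rightarrow> 'v \<Rightarrow> 'e \<Rightarrow> 'e"
  assumes "class_X_group X Q Qp"
    and "set qs \<subseteq> Qp"
    and "class_X_module X Q Qp M mp"
    and "\<forall>i < length qs. minkowski_summable X {real n *\<^sub>R (qs ! i) | n. True}"
  shows "\<forall>l. class_X_module X Q Qp (cech M mp qs l) (cech_map M mp qs l) \<and>
             class_X_hom X Q Qp (cech M mp qs l) (cech_map M mp qs l)
                (cech M mp qs (Suc l)) (cech_map M mp qs (Suc l)) (cech_d M mp qs l) \<and>
             class_X_module X Q Qp (loccoh M mp qs l) (loccoh_map M mp qs l)"
proof -
  have po: "po_group Q Qp" and X: "class_X_family X Q Qp" and Qp: "Qp \<in> X"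
    using assms(1) unfolding class_X_group_def by auto
  \<comment> \<open>Membership of \<open>Q\<close> in the family is not an axiom; it follows from
    that of \<open>Qp\<close> and its complement.\<close>
  have "Qp \<union> (Q - Qp) \<in> X" using X Qp unfolding class_X_family_def by blast
  moreover have "Qp \<union> (Q - Qp) = Q" using po unfolding po_group_def by blast
  ultimately have QX: "Q \<in> X" by simp
  obtain P MI phi psi where qmod: "is_qmod Q Qp M mp" and fd: "\<And>q. q \<in> Q \<Longrightarrow> fin_dim (M q)"
    and sub: "const_subdiv X Q Qp M mp P MI phi psi"
    using assms(3) unfolding class_X_module_def by blast
  interpret subdivided_module Q Qp M mp X P MI phi psi
    using po qmod fd sub by unfold_locales
  define F where "F = (\<lambda>(S, I). often Q qs S I) ` (Pow {..<length qs} \<times> P)"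
  have "often Q qs S I \<in> X" if "S \<subseteq> {..<length qs}" "I \<in> P" for S I
  proof (rule often_class[OF X])
    show "finite S" using finite_subset[OF that(1)] by simp
    show "minkowski_summable X {real n *\<^sub>R (qs ! i) | n. True}" if "i \<in> S" for i
      using assms(4) that \<open>S \<subseteq> {..<length qs}\<close> by blast
    show "I \<in> X" using that regions(2) by blast
    show "q + c \<in> Q" if "q \<in> Q" "c \<in> ncone qs S" for q c
      using ncone_bounded(1)[OF assms(2) \<open>S \<subseteq> {..<length qs}\<close>] that by (simp add: Qp_Q)
  qed
  then have F: "finite F" "F \<subseteq> X" using regions(1) by (auto simp: F_def)
  from atoms_partition[OF X QX F] obtain R where R: "region_partition X Q R"
    and R_const: "\<forall>B\<in>R. \<forall>q\<in>B. \<forall>q'\<in>B. \<forall>D\<in>F. q \<in> D \<longleftrightarrow> q' \<in> D"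
    by (elim exE conjE)
  \<comment> \<open>The choice sees \<open>q\<close> only through its membership in the sets
    \<open>often Q qs S I\<close>, so it is constant on the atoms.\<close>
  define rg where "rg S q = (SOME I. I \<in> P \<and> q \<in> often Q qs S I)" for S q
  have rg: "rg S q \<in> P \<and> q \<in> often Q qs S (rg S q)" if "S \<subseteq> {..<length qs}" "q \<in> Q" for S q
    unfolding rg_def by (rule someI_ex) (use often_ex[OF assms(2) that] in blast)
  interpret cech_module Q Qp M mp X P MI phi psi qs R rg
  proof
    show "rg S q = rg S q'" if "S \<subseteq> {..<length qs}" "B \<in> R" "q \<in> B" "q' \<in> B" for S B q q'
    proof -
      have "often Q qs S I \<in> F" if "I \<in> P" for I
        using that \<open>S \<subseteq> {..<length qs}\<close> by (auto simp: F_def)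
      then have "(\<lambda>I. I \<in> P \<and> q \<in> often Q qs S I) = (\<lambda>I. I \<in> P \<and> q' \<in> often Q qs S I)"
        using R_const[rule_format, OF that(2-4)] by (auto simp: fun_eq_iff)
      then show ?thesis by (simp add: rg_def)
    qed
    show "rg S q \<in> P" "cofinal (rg S q) (psum qs S) q" if "S \<subseteq> {..<length qs}" "q \<in> Q" for S q
      using rg[OF that] often_cofinal[OF assms(2) that(1)] by auto
  qed (fact assms(2) R)+
  show ?thesis
    using cech_class_X_module cech_d_class_X_hom loccoh_class_X_module by blast
qed

end
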